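(* Given $K>0$, there exists a constant $C_K>0$ such that for any compact subset $\Omega$ of $\mathbb{R}^d$, any probability measure $\mu$ on $\Omega$, any integers $1\le v\le N$, any dictionary $\Phi_N=\{\varphi_j\}_{j=1}^N\subset\mathcal{C}(\Omega)$ satisfying $\sup_{x\in\Omega}|\varphi_j(x)|\le1$ ($1\le j\le N$) and $\sum_{j=1}^N|a_j|^2\le K\|\sum_{j=1}^Na_j\varphi_j\|_{L_2(\Omega,\mu)}^2$ for all $(a_j)\in\mathbb{C}^N$, and any $W$ which is the unit ball of a Banach space $V\subset\mathcal{C}(\Omega)$, we have $$\kappa_m(W)\le5\,\sigma_v(W,\Phi_N)_\infty$$ provided $m\ge C_K\,v(\log N)(\log(2v))^2(\log(2v)+\log\log N)$.
   Context: $I_\mu(f)=\int_\Omega fd\mu$; $\kappa_m(\mathbf{F}):=\inf_{\xi^1,\dots,\xi^m\in\Omega;\ \lambda_1,\dots,\lambda_m}\sup_{f\in\mathbf{F}}|I_\mu(f)-\sum_{\nu=1}^m\lambda_\nu f(\xi^\nu)|$. $\Sigma_v(\Phi_N)$ is the union of all spaces $\operatorname{span}\{\varphi_j:j\in J\}$, $J\subset\{1,\dots,N\}$, $|J|=v$, and $\sigma_v(\mathbf{F},\Phi_N)_\infty=\sup_{f\in\mathbf{F}}\inf_{g\in\Sigma_v(\Phi_N)}\max_{x\in\Omega}|f(x)-g(x)|$. *)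

theory Defs
  imports "HOL-Probability.Probability"
begin

text \<open>Points of \<open>R^d\<close> are represented as functions \<open>nat \<Rightarrow> real\<close> vanishing at
  indices \<open>\<ge> d\<close> (product topology = Euclidean topology on that subspace); this lets the
  dimension d be quantified inside the statement, after the constant.
  Elements of C(Omega) are complex functions continuous on Omega, extended by 0 outside Omega.\<close>

definition banach_subspace_C ::
  "('x::topological_space) set \<Rightarrow> ('x \<Rightarrow> complex) set \<Rightarrow> (('x \<Rightarrow> complex) \<Rightarrow> real) \<Rightarrow> bool" where
  "banach_subspace_C \<Omega> V nv \<longleftrightarrow>
     V \<subseteq> {f. continuous_on \<Omega> f \<and> (\<forall>x. x \<notin> \<Omega> \<longrightarrow> f x = 0)} \<and>
     (\<lambda>x. 0) \<in> V \<and>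
     (\<forall>f\<in>V. \<forall>g\<in>V. (\<lambda>x. f x + g x) \<in> V) \<and>
     (\<forall>c f. f \<in> V \<longrightarrow> (\<lambda>x. c * f x) \<in> V) \<and>
     (\<forall>f\<in>V. nv f \<ge> 0 \<and> (nv f = 0 \<longleftrightarrow> f = (\<lambda>x. 0))) \<and>
     (\<forall>f\<in>V. \<forall>g\<in>V. nv (\<lambda>x. f x + g x) \<le> nv f + nv g) \<and>
     (\<forall>c. \<forall>f\<in>V. nv (\<lambda>x. c * f x) = cmod c * nv f) \<and>
     (\<forall>u. (\<forall>n. u n \<in> V) \<and> (\<forall>e>0. \<exists>M. \<forall>n\<ge>M. \<forall>k\<ge>M. nv (\<lambda>x. u n x - u k x) < e)
          \<longrightarrow> (\<exists>f\<in>V. (\<lambda>n. nv (\<lambda>x. u n x - f x)) \<longlonglongrightarrow> 0))"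

definition kappa :: "nat \<Rightarrow> 'x measure \<Rightarrow> 'x set \<Rightarrow> ('x \<Rightarrow> complex) set \<Rightarrow> ereal" where
  "kappa m \<mu> \<Omega> F =
     (INF p \<in> {p::(nat \<Rightarrow> 'x) \<times> (nat \<Rightarrow> complex). \<forall>\<nu><m. fst p \<nu> \<in> \<Omega>}.
        SUP f \<in> F. ereal (cmod (integral\<^sup>L \<mu> f - (\<Sum>\<nu><m. snd p \<nu> * f (fst p \<nu>)))))"

definition sparse_span :: "nat \<Rightarrow> nat \<Rightarrow> (nat \<Rightarrow> 'x \<Rightarrow> complex) \<Rightarrow> ('x \<Rightarrow> complex) set" where
  "sparse_span v N \<phi> = {g. \<exists>J (a::nat \<Rightarrow> complex). J \<subseteq> {1..N} \<and> card J = v \<and>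
        g = (\<lambda>x. \<Sum>j\<in>J. a j * \<phi> j x)}"

definition sigma_inf :: "nat \<Rightarrow> nat \<Rightarrow> (nat \<Rightarrow> 'x \<Rightarrow> complex) \<Rightarrow> 'x set \<Rightarrow> ('x \<Rightarrow> complex) set \<Rightarrow> ereal" where
  "sigma_inf v N \<phi> \<Omega> F =
     (SUP f \<in> F. INF g \<in> sparse_span v N \<phi>. SUP x \<in> \<Omega>. ereal (cmod (f x - g x)))"

end

theory Submission
  imports Defs
begin

text \<open>By duality (a ball is convex and balanced) it suffices to find points \<open>\<xi>\<close> such that
  \<open>|I f| \<le> 5 \<sigma>\<close> for every \<open>f\<close> in the ball that vanishes on \<open>\<xi>\<close>. Approximating \<open>f\<close> by a
  \<open>v\<close>-sparse \<open>g\<close>, this follows from the one-sided discretisation \<open>\<parallel>g\<parallel>\<^sub>2 \<le> 4 max |g(\<xi>)|\<close> for all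
  \<open>v\<close>-sparse \<open>g\<close>, which is weaker than a restricted isometry and needs no chaining. Normalise
  \<open>\<parallel>g\<parallel>\<^sub>2 = 1\<close>; then the coefficients have \<open>\<ell>\<^sub>1\<close>-norm at most \<open>sqrt (K v)\<close>, and some dyadic level set
  \<open>{|g| \<ge> 2^i / 2}\<close> has measure at least of order \<open>4^(-i) / log v\<close>. By Maurey's method \<open>g\<close> is within
  \<open>2^i / 8\<close>, off a small exceptional set, of an average of about \<open>K v 4^(-i) log v\<close> dictionary
  elements. There are few such averages, so by a Chernoff and union bound one choice of points
  hits all their large level sets often enough to leave the exceptional set.\<close>

subsection \<open>Linear rules from zero data\<close>

text \<open>Only real scalars, because the Hahn-Banach argument below treats one real-valued
  functional at a time. Closure of \<open>V\<close> is recorded in \<open>real_seminormed\<close>;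
  both predicates pass to the kernel of a real-linear functional, which the induction uses.\<close>

definition real_linear_on :: "('x \<Rightarrow> complex) set \<Rightarrow> (('x \<Rightarrow> complex) \<Rightarrow> real) \<Rightarrow> bool" where
  "real_linear_on V L \<longleftrightarrow>
     (\<forall>f\<in>V. \<forall>g\<in>V. L (\<lambda>x. f x + g x) = L f + L g) \<and>
     (\<forall>c. \<forall>f\<in>V. L (\<lambda>x. complex_of_real c * f x) = c * L f)"

definition real_seminormed :: "('x \<Rightarrow> complex) set \<Rightarrow> (('x \<Rightarrow> complex) \<Rightarrow> real) \<Rightarrow> bool" where
  "real_seminormed V q \<longleftrightarrow>
     (\<forall>f\<in>V. \<forall>g\<in>V. (\<lambda>x. f x + g x) \<in> V \<and> q (\<lambda>x. f x + g x) \<le> q f + q g) \<and>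
     (\<forall>c. \<forall>f\<in>V. (\<lambda>x. complex_of_real c * f x) \<in> V \<and> q (\<lambda>x. complex_of_real c * f x) = \<bar>c\<bar> * q f)"

text \<open>Hahn-Banach in dual form: instead of extending \<open>L\<close> from the kernel of
  \<open>e\<close>, a multiple of \<open>e\<close> is subtracted from it. If
  \<open>e f = e g = 1\<close>, then \<open>f - g\<close> lies in the kernel, so
  \<open>L f - q f <= L g + q g\<close>. A number \<open>c\<close> separating the two sides works on
  this hyperplane, and homogeneity carries it to all \<open>f\<close> with \<open>e f\<close>
  nonzero.\<close>

lemma functional_extension_step:
  assumes V: "real_seminormed V q" and L: "real_linear_on V L" and e: "real_linear_on V e"
    and bound: "\<And>f. f \<in> V \<Longrightarrow> e f = 0 \<Longrightarrow> \<bar>L f\<bar> \<le> q f"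
  shows "\<exists>c. \<forall>f\<in>V. \<bar>L f - c * e f\<bar> \<le> q f"
proof (cases "\<forall>f\<in>V. e f = 0")
  case True
  then show ?thesis using bound by (intro exI[of _ 0]) auto
next
  case False
  have Vadd: "(\<lambda>x. f x + g x) \<in> V" "q (\<lambda>x. f x + g x) \<le> q f + q g" if "f \<in> V" "g \<in> V" for f g
    using V that unfolding real_seminormed_def by blast+
  have Vsc: "(\<lambda>x. complex_of_real c * f x) \<in> V" "q (\<lambda>x. complex_of_real c * f x) = \<bar>c\<bar> * q f"
    if "f \<in> V" for f c using V that unfolding real_seminormed_def by blast+
  have Ladd: "L (\<lambda>x. f x + g x) = L f + L g" "e (\<lambda>x. f x + g x) = e f + e g" if "f \<in> V" "g \<in> V" for f g
    using L e that unfolding real_linear_on_def by blast+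
  have Lsc: "L (\<lambda>x. complex_of_real c * f x) = c * L f" "e (\<lambda>x. complex_of_real c * f x) = c * e f"
    if "f \<in> V" for f c using L e that unfolding real_linear_on_def by blast+
  define A where "A = {f \<in> V. e f = 1}"
  have "A \<noteq> {}"
  proof -
    obtain f where f: "f \<in> V" "e f \<noteq> 0" using False by blast
    have "(\<lambda>x. complex_of_real (1 / e f) * f x) \<in> A"
      unfolding A_def using f Vsc(1)[of f "1 / e f"] Lsc(2)[of f "1 / e f"] by simp
    then show ?thesis by blast
  qed
  have le: "L f - q f \<le> L g + q g" if "f \<in> A" "g \<in> A" for f g
  proof -
    have fg: "f \<in> V" "g \<in> V" "e f = 1" "e g = 1" using that unfolding A_def by auto
    define g' where "g' = (\<lambda>x. complex_of_real (-1) * g x)"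
    have g': "g' \<in> V" "q g' = q g" "L g' = - L g" "e g' = -1"
      unfolding g'_def using Vsc[of g "-1"] Lsc[of g "-1"] fg by simp_all
    have "\<bar>L (\<lambda>x. f x + g' x)\<bar> \<le> q (\<lambda>x. f x + g' x)"
      by (rule bound) (use fg g' Vadd Ladd in auto)
    then show ?thesis using Ladd(1)[OF fg(1) g'(1)] Vadd(2)[OF fg(1) g'(1)] g' by linarith
  qed
  define c where "c = (SUP f\<in>A. L f - q f)"
  have bdd: "bdd_above ((\<lambda>f. L f - q f) ` A)"
    using \<open>A \<noteq> {}\<close> le unfolding bdd_above_def by blast
  have c1: "L f - q f \<le> c" if "f \<in> A" for f
    unfolding c_def using bdd that by (rule cSUP_upper[rotated])
  have c2: "c \<le> L f + q f" if "f \<in> A" for f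
    unfolding c_def using \<open>A \<noteq> {}\<close> le that by (intro cSUP_least) auto
  have "\<bar>L f - c * e f\<bar> \<le> q f" if f: "f \<in> V" for f
  proof (cases "e f = 0")
    case True
    then show ?thesis using bound f by simp
  next
    case False
    define h where "h = (\<lambda>x. complex_of_real (1 / e f) * f x)"
    have h: "h \<in> A" "L h = L f / e f" "q h = q f / \<bar>e f\<bar>"
      unfolding A_def h_def using f Vsc[of f "1 / e f"] Lsc[of f "1 / e f"] False by simp_all
    have "\<bar>L h - c\<bar> \<le> q h" using c1[OF h(1)] c2[OF h(1)] by linarith
    then have "\<bar>e f\<bar> * \<bar>L h - c\<bar> \<le> \<bar>e f\<bar> * q h" by (intro mult_left_mono) auto
    moreover have "\<bar>e f\<bar> * \<bar>L h - c\<bar> = \<bar>L f - c * e f\<bar>"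
      using False by (simp add: h(2) abs_mult[symmetric] algebra_simps)
    ultimately show ?thesis using False h(3) by simp
  qed
  then show ?thesis by blast
qed

text \<open>The induction hypothesis is applied to the kernel of the last functional, hence
  \<open>V\<close> is arbitrary in the induction; \<open>functional_extension_step\<close> then
  restores \<open>e n\<close>.\<close>

lemma functional_extension:
  fixes e :: "nat \<Rightarrow> ('x \<Rightarrow> complex) \<Rightarrow> real"
  assumes "real_seminormed V q" "real_linear_on V L" "\<And>i. i < n \<Longrightarrow> real_linear_on V (e i)"
    and "\<And>f. f \<in> V \<Longrightarrow> (\<forall>i<n. e i f = 0) \<Longrightarrow> \<bar>L f\<bar> \<le> q f"
  shows "\<exists>c. \<forall>f\<in>V. \<bar>L f - (\<Sum>i<n. c i * e i f)\<bar> \<le> q f"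
  using assms
proof (induction n arbitrary: V)
  case 0
  then show ?case by simp
next
  case (Suc n)
  let ?V' = "{f \<in> V. e n f = 0}"
  have en: "real_linear_on V (e n)" using Suc.prems(3) by simp
  have "real_seminormed ?V' q"
    using Suc.prems(1) en unfolding real_seminormed_def real_linear_on_def by simp
  moreover have sub: "real_linear_on ?V' F" if "real_linear_on V F" for F
    using that unfolding real_linear_on_def by simp
  ultimately have "\<exists>c. \<forall>f\<in>?V'. \<bar>L f - (\<Sum>i<n. c i * e i f)\<bar> \<le> q f"
    using Suc.prems by (intro Suc.IH) (auto simp: less_Suc_eq)
  then obtain c where c: "\<And>f. f \<in> V \<Longrightarrow> e n f = 0 \<Longrightarrow> \<bar>L f - (\<Sum>i<n. c i * e i f)\<bar> \<le> q f"
    by blast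
  have "real_linear_on V (\<lambda>f. L f - (\<Sum>i<n. c i * e i f))"
    unfolding real_linear_on_def
  proof safe
    fix f g assume fg: "f \<in> V" "g \<in> V"
    have "e i (\<lambda>x. f x + g x) = e i f + e i g" if "i < n" for i
      using Suc.prems(3)[of i] that fg unfolding real_linear_on_def by simp
    moreover have "L (\<lambda>x. f x + g x) = L f + L g"
      using Suc.prems(2) fg unfolding real_linear_on_def by simp
    ultimately show "L (\<lambda>x. f x + g x) - (\<Sum>i<n. c i * e i (\<lambda>x. f x + g x))
        = L f - (\<Sum>i<n. c i * e i f) + (L g - (\<Sum>i<n. c i * e i g))"
      by (simp add: distrib_left sum.distrib)
  next
    fix r f assume f: "f \<in> V"
    have "e i (\<lambda>x. complex_of_real r * f x) = r * e i f" if "i < n" for i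
      using Suc.prems(3)[of i] that f unfolding real_linear_on_def by simp
    moreover have "L (\<lambda>x. complex_of_real r * f x) = r * L f"
      using Suc.prems(2) f unfolding real_linear_on_def by simp
    ultimately show "L (\<lambda>x. complex_of_real r * f x) - (\<Sum>i<n. c i * e i (\<lambda>x. complex_of_real r * f x))
        = r * (L f - (\<Sum>i<n. c i * e i f))"
      by (simp add: right_diff_distrib sum_distrib_left mult.left_commute)
  qed
  from functional_extension_step[OF Suc.prems(1) this en c]
  obtain b where b: "\<forall>f\<in>V. \<bar>L f - (\<Sum>i<n. c i * e i f) - b * e n f\<bar> \<le> q f" by blast
  show ?case
  proof (intro exI[of _ "c(n := b)"] ballI)
    fix f assume "f \<in> V"
    have "(\<Sum>i<Suc n. (c(n := b)) i * e i f) = (\<Sum>i<n. c i * e i f) + b * e n f"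
      by simp
    then show "\<bar>L f - (\<Sum>i<Suc n. (c(n := b)) i * e i f)\<bar> \<le> q f"
      using b \<open>f \<in> V\<close> by (simp add: algebra_simps)
  qed
qed

text \<open>Lemma of Bakhvalov and Smolyak. The extension is applied to \<open>Re I\<close> with data
  \<open>Re (f (\<xi> \<nu>))\<close>, \<open>Im (f (\<xi> \<nu>))\<close>; a rotation of \<open>f\<close> then gives the complex bound.\<close>

lemma linear_rule_of_zero_data:
  fixes I :: "('x \<Rightarrow> complex) \<Rightarrow> complex" and \<xi> :: "nat \<Rightarrow> 'x"
  assumes add: "\<And>f g. f \<in> V \<Longrightarrow> g \<in> V \<Longrightarrow>
        (\<lambda>x. f x + g x) \<in> V \<and> q (\<lambda>x. f x + g x) \<le> q f + q g \<and> I (\<lambda>x. f x + g x) = I f + I g"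
    and scale: "\<And>c f. f \<in> V \<Longrightarrow>
        (\<lambda>x. c * f x) \<in> V \<and> q (\<lambda>x. c * f x) = cmod c * q f \<and> I (\<lambda>x. c * f x) = c * I f"
    and R: "R \<ge> 0"
    and zero: "\<And>f. f \<in> V \<Longrightarrow> (\<forall>\<nu><m. f (\<xi> \<nu>) = 0) \<Longrightarrow> cmod (I f) \<le> R * q f"
  shows "\<exists>w. \<forall>f\<in>V. cmod (I f - (\<Sum>\<nu><m. w \<nu> * f (\<xi> \<nu>))) \<le> R * q f"
proof -
  define e where "e i f = (if even i then Re (f (\<xi> (i div 2))) else Im (f (\<xi> (i div 2))))"
    for i :: nat and f
  have "\<exists>c. \<forall>f\<in>V. \<bar>Re (I f) - (\<Sum>i<2*m. c i * e i f)\<bar> \<le> R * q f"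
  proof (rule functional_extension[where q = "\<lambda>f. R * q f"])
    show "real_seminormed V (\<lambda>f. R * q f)"
      unfolding real_seminormed_def using add scale R
      by (auto simp: distrib_left[symmetric] intro: mult_left_mono)
    show "real_linear_on V (\<lambda>f. Re (I f))"
      unfolding real_linear_on_def using add scale by auto
    show "real_linear_on V (e i)" for i
      unfolding real_linear_on_def e_def by simp
    fix f assume f: "f \<in> V" and z: "\<forall>i<2*m. e i f = 0"
    have "f (\<xi> \<nu>) = 0" if "\<nu> < m" for \<nu>
      using z[rule_format, of "2 * \<nu>"] z[rule_format, of "2 * \<nu> + 1"] that
      by (simp add: e_def complex_eq_iff)
    then show "\<bar>Re (I f)\<bar> \<le> R * q f"
      using zero[OF f] abs_Re_le_cmod[of "I f"] by fastforce
  qed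
  then obtain c where c: "\<And>f. f \<in> V \<Longrightarrow> \<bar>Re (I f) - (\<Sum>i<2*m. c i * e i f)\<bar> \<le> R * q f"
    by blast
  \<comment> \<open>With these weights \<open>Re (w \<nu> * z)\<close> equals
    \<open>c (2 * \<nu>) * Re z + c (2 * \<nu> + 1) * Im z\<close>, so the real rule is the real
    part of a complex one.\<close>
  define w where "w \<nu> = Complex (c (2 * \<nu>)) (- c (2 * \<nu> + 1))" for \<nu>
  define D where "D f = I f - (\<Sum>\<nu><m. w \<nu> * f (\<xi> \<nu>))" for f
  have split: "(\<Sum>i<2*n. F i) = (\<Sum>\<nu><n. F (2 * \<nu>) + F (2 * \<nu> + 1))" for F :: "nat \<Rightarrow> real" and n
    by (induction n) (simp_all add: algebra_simps)
  have ReD: "\<bar>Re (D f)\<bar> \<le> R * q f" if "f \<in> V" for f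
    using c[OF that] unfolding D_def split w_def e_def by simp
  have "cmod (D f) \<le> R * q f" if f: "f \<in> V" for f
  proof (cases "D f = 0")
    case True
    have "0 \<le> R * q f" using c[OF f] by linarith
    then show ?thesis using True by simp
  next
    case False
    define z where "z = cnj (D f) / cmod (D f)"
    have z: "cmod z = 1" using False by (simp add: z_def norm_divide)
    have "D (\<lambda>x. z * f x) = z * D f"
      using scale[OF f, of z] unfolding D_def
      by (simp add: right_diff_distrib sum_distrib_left mult.left_commute)
    also have "\<dots> = cmod (D f)"
      using False complex_norm_square[of "D f"] unfolding z_def
      by (simp add: power2_eq_square field_simps)
    finally have "D (\<lambda>x. z * f x) = cmod (D f)" .
    then show ?thesis using ReD[of "\<lambda>x. z * f x"] scale[OF f, of z] z by simp
  qed
  then show ?thesis unfolding D_def by blast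
qed

subsection \<open>Sampling points and empirical approximation\<close>

text \<open>The averaging principle by which each sampling point is selected.\<close>

lemma (in prob_space) exists_le_expectation:
  fixes f :: "'a \<Rightarrow> real"
  assumes "integrable M f"
  shows "\<exists>x\<in>space M. f x \<le> expectation f"
proof (rule ccontr)
  assume "\<not> ?thesis"
  then have "AE x in M. expectation f < f x" by (intro AE_I2) auto
  from expectation_greater[OF assms this] show False by simp
qed

text \<open>Chernoff and union bound, derandomised: the points are chosen one at a time so that the
  exponential potential does not increase.\<close>

lemma (in prob_space) points_hitting_events:
  fixes E :: "'i \<Rightarrow> 'a set"
  assumes fin: "finite I" and c: "\<And>i. i \<in> I \<Longrightarrow> 0 < c i" and c1: "(\<Sum>i\<in>I. c i) \<le> 1"
    and E: "\<And>i. i \<in> I \<Longrightarrow> E i \<in> events"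
  shows "\<exists>\<xi>::nat \<Rightarrow> 'a. (\<forall>\<nu>. \<xi> \<nu> \<in> space M) \<and>
           (\<forall>i\<in>I. real m * prob (E i) / 2 + ln (c i) \<le> real (card {\<nu>. \<nu> < m \<and> \<xi> \<nu> \<in> E i}))"
proof -
  let ?hits = "\<lambda>\<xi> n i. real (card {\<nu>. \<nu> < n \<and> \<xi> \<nu> \<in> E i})"
  \<comment> \<open>The potential of \<open>n\<close> points: an event hit much less often than half
    its expected number of times makes its own term large.\<close>
  have "\<exists>\<xi>::nat \<Rightarrow> 'a. (\<forall>\<nu>. \<xi> \<nu> \<in> space M) \<and>
          (\<Sum>i\<in>I. c i * exp (real n * prob (E i) / 2 - ?hits \<xi> n i)) \<le> 1" for n
  proof (induction n)
    case 0
    obtain x where "x \<in> space M" using not_empty by blast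
    then show ?case using c1 by (intro exI[of _ "\<lambda>_. x"]) simp
  next
    case (Suc n)
    then obtain \<xi> where \<xi>: "\<And>\<nu>. \<xi> \<nu> \<in> space M"
      and le: "(\<Sum>i\<in>I. c i * exp (real n * prob (E i) / 2 - ?hits \<xi> n i)) \<le> 1" by blast
    define b where "b i = c i * exp (real n * prob (E i) / 2 - ?hits \<xi> n i)" for i
    have b: "0 \<le> b i" if "i \<in> I" for i using c[OF that] by (simp add: b_def)
    define F where
      \<comment> \<open>\<open>F x\<close> dominates the potential after the point \<open>x\<close>
        is added: a hit divides a term by e, which \<open>1 - 1/2\<close> bounds since
        \<open>exp (-1) <= 1/2\<close>. Its mean is at most the old potential because
        \<open>exp (p / 2) * (1 - p / 2) <= 1\<close>.\<close>
      "F x = (\<Sum>i\<in>I. b i * (exp (prob (E i) / 2) * (1 - indicator (E i) x / 2)))" for x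
    have ind: "integrable M (\<lambda>x. indicat_real (E i) x)" if "i \<in> I" for i
      using E[OF that] by (auto simp: less_top[symmetric])
    then have int: "integrable M F" unfolding F_def
      by (intro Bochner_Integration.integrable_sum integrable_mult_right Bochner_Integration.integrable_diff
          integrable_divide) auto
    have "expectation F = (\<Sum>i\<in>I. b i * (exp (prob (E i) / 2) * (1 - prob (E i) / 2)))"
    proof -
      have "integrable M (\<lambda>x. 1 - indicat_real (E i) x / 2)" if "i \<in> I" for i
        using ind[OF that] by (intro Bochner_Integration.integrable_diff integrable_divide) auto
      moreover have "expectation (\<lambda>x. 1 - indicat_real (E i) x / 2) = 1 - prob (E i) / 2" if "i \<in> I" for i
        using ind[OF that] E[OF that]
        by (subst Bochner_Integration.integral_diff) (auto intro: integrable_divide simp: prob_space)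
      ultimately show ?thesis
        unfolding F_def by (subst Bochner_Integration.integral_sum) auto
    qed
    also have "\<dots> \<le> (\<Sum>i\<in>I. b i * 1)"
    proof (intro sum_mono mult_left_mono b)
      fix i assume "i \<in> I"
      have "1 - prob (E i) / 2 \<le> exp (- (prob (E i) / 2))"
        using exp_ge_add_one_self[of "- (prob (E i) / 2)"] by simp
      then have "exp (prob (E i) / 2) * (1 - prob (E i) / 2)
          \<le> exp (prob (E i) / 2) * exp (- (prob (E i) / 2))"
        by (intro mult_left_mono) auto
      then show "exp (prob (E i) / 2) * (1 - prob (E i) / 2) \<le> 1"
        by (simp add: exp_minus)
    qed
    also have "\<dots> \<le> 1" using le by (simp add: b_def)
    finally obtain x where x: "x \<in> space M" "F x \<le> 1"
      using exists_le_expectation[OF int] by force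
    define \<xi>' where "\<xi>' = \<xi>(n := x)"
    have hits: "?hits \<xi>' (Suc n) i = ?hits \<xi> n i + indicator (E i) x" for i
    proof -
      have "{\<nu>. \<nu> < Suc n \<and> \<xi>' \<nu> \<in> E i}
          = {\<nu>. \<nu> < n \<and> \<xi> \<nu> \<in> E i} \<union> (if x \<in> E i then {n} else {})"
        by (auto simp: \<xi>'_def less_Suc_eq)
      then show ?thesis by (simp add: indicator_def)
    qed
    have e: "exp (-1::real) \<le> 1/2"
      using exp_ge_add_one_self[of "1::real"] by (simp add: exp_minus field_simps)
    have "(\<Sum>i\<in>I. c i * exp (real (Suc n) * prob (E i) / 2 - ?hits \<xi>' (Suc n) i)) \<le> F x"
      unfolding F_def
    proof (rule sum_mono)
      fix i assume i: "i \<in> I"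
      have "c i * exp (real (Suc n) * prob (E i) / 2 - ?hits \<xi>' (Suc n) i)
          = c i * exp ((real n * prob (E i) / 2 - ?hits \<xi> n i) + prob (E i) / 2 + - indicator (E i) x)"
        unfolding hits by (simp add: field_simps)
      also have "\<dots> = b i * (exp (prob (E i) / 2) * exp (- indicator (E i) x))"
        unfolding exp_add b_def by simp
      also have "\<dots> \<le> b i * (exp (prob (E i) / 2) * (1 - indicator (E i) x / 2))"
        using e b[OF i] by (intro mult_left_mono) (auto simp: indicator_def)
      finally show "c i * exp (real (Suc n) * prob (E i) / 2 - ?hits \<xi>' (Suc n) i)
          \<le> b i * (exp (prob (E i) / 2) * (1 - indicator (E i) x / 2))" .
    qed
    then have "(\<Sum>i\<in>I. c i * exp (real (Suc n) * prob (E i) / 2 - ?hits \<xi>' (Suc n) i)) \<le> 1"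
      using x by linarith
    moreover have "\<forall>\<nu>. \<xi>' \<nu> \<in> space M" using \<xi> x by (simp add: \<xi>'_def)
    ultimately show ?case by blast
  qed
  then obtain \<xi> where \<xi>: "\<forall>\<nu>. \<xi> \<nu> \<in> space M"
    and le: "(\<Sum>i\<in>I. c i * exp (real m * prob (E i) / 2 - ?hits \<xi> m i)) \<le> 1" by blast
  \<comment> \<open>Each term alone is at most the whole potential, hence at most 1; its logarithm
    gives the number of hits.\<close>
  have "real m * prob (E i) / 2 + ln (c i) \<le> ?hits \<xi> m i" if i: "i \<in> I" for i
  proof -
    have "c i * exp (real m * prob (E i) / 2 - ?hits \<xi> m i)
        \<le> (\<Sum>i\<in>I. c i * exp (real m * prob (E i) / 2 - ?hits \<xi> m i))"
      using c fin i by (intro member_le_sum) (auto intro: less_imp_le)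
    also note le
    finally have "ln (c i * exp (real m * prob (E i) / 2 - ?hits \<xi> m i)) \<le> 0"
      using c[OF i] by simp
    then show ?thesis using c[OF i] by (simp add: ln_mult)
  qed
  then show ?thesis using \<xi> by blast
qed

section \<open>Exponential moments and Maurey's method\<close>

text \<open>For negative \<open>y\<close> this comes from the lower Taylor bound for
  \<open>exp (- y)\<close>, because
  \<open>(1 - y + y^2 / 2) * (1 + y + y^2 / 2) = 1 + y^4 / 4 >= 1\<close>.\<close>

lemma exp_le_quadratic:
  fixes y :: real
  assumes "\<bar>y\<bar> \<le> 1"
  shows "exp y \<le> 1 + y + y\<^sup>2"
proof (cases "0 \<le> y")
  case True
  then show ?thesis using exp_bound[of y] assms by simp
next
  case False
  then have "1 - y + y\<^sup>2 / 2 \<le> exp (- y)"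
    using exp_lower_Taylor_quadratic[of "- y"] by simp
  then have "(1 - y + y\<^sup>2 / 2) * exp y \<le> exp (-y) * exp y" by (intro mult_right_mono) auto
  also have "\<dots> = 1" by (simp add: exp_minus)
  also have "\<dots> \<le> 1 + y^4 / 4" by simp
  also have "\<dots> = (1 - y + y\<^sup>2 / 2) * (1 + y + y\<^sup>2 / 2)" 
    by (simp add: power2_eq_square field_simps power4_eq_xxxx)
  finally have "exp y \<le> 1 + y + y\<^sup>2 / 2"
    using False by (subst (asm) mult_le_cancel_left_pos) (auto intro: add_pos_nonneg)
  then show ?thesis using zero_le_power2[of y] by linarith
qed

lemma of_real_mult_Re: "Re (complex_of_real c * z) = c * Re z"
  by simp

text \<open>One step of the moment bound. The values \<open>\<psi> d\<close> and their mean
  \<open>g\<close> lie in the unit disc, so the exponent has modulus at most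
  \<open>2 * r <= 1\<close>. In \<open>exp_le_quadratic\<close> the linear term averages to 0 and
  the quadratic one is at most \<open>4 * r^2\<close>.\<close>

lemma exp_mean_le:
  fixes \<psi> :: "'d \<Rightarrow> complex" and w :: "'d \<Rightarrow> real"
  assumes w: "\<And>d. d \<in> D \<Longrightarrow> 0 \<le> w d" "(\<Sum>d\<in>D. w d) = 1"
    and \<psi>: "\<And>d. d \<in> D \<Longrightarrow> cmod (\<psi> d) \<le> 1"
    and g: "g = (\<Sum>d\<in>D. complex_of_real (w d) * \<psi> d)"
    and u: "cmod u = 1" and r: "0 \<le> r" "r \<le> 1/2"
  shows "cmod g \<le> 1" "(\<Sum>d\<in>D. w d * exp (r * Re (u * (\<psi> d - g)))) \<le> exp (4 * r\<^sup>2)"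
proof -
  have "cmod g \<le> (\<Sum>d\<in>D. cmod (complex_of_real (w d) * \<psi> d))" unfolding g by (rule norm_sum)
  also have "\<dots> \<le> (\<Sum>d\<in>D. w d * 1)" using w \<psi> by (intro sum_mono) (auto simp: norm_mult intro!: mult_left_le)
  finally show g1: "cmod g \<le> 1" using w by simp
  define y where "y d = r * Re (u * (\<psi> d - g))" for d
  have y: "\<bar>y d\<bar> \<le> 2 * r" if "d \<in> D" for d
  proof -
    have "\<bar>Re (u * (\<psi> d - g))\<bar> \<le> cmod (\<psi> d - g)"
      using abs_Re_le_cmod[of "u * (\<psi> d - g)"] u by (simp add: norm_mult)
    also have "\<dots> \<le> 2" using norm_triangle_ineq4[of "\<psi> d" g] \<psi>[OF that] g1 by linarith
    finally have "r * \<bar>Re (u * (\<psi> d - g))\<bar> \<le> r * 2" using r by (intro mult_left_mono)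
    then show ?thesis using r by (simp add: y_def abs_mult)
  qed
  have "(\<Sum>d\<in>D. complex_of_real (w d) * (\<psi> d - g)) = g - complex_of_real (\<Sum>d\<in>D. w d) * g"
    by (simp add: g right_diff_distrib sum_subtractf sum_distrib_right)
  then have "(\<Sum>d\<in>D. complex_of_real (w d) * (\<psi> d - g)) = 0" using w by simp
  then have "Re (u * (\<Sum>d\<in>D. complex_of_real (w d) * (\<psi> d - g))) = 0" by simp
  also have "u * (\<Sum>d\<in>D. complex_of_real (w d) * (\<psi> d - g))
      = (\<Sum>d\<in>D. complex_of_real (w d) * (u * (\<psi> d - g)))"
    by (simp add: sum_distrib_left mult.left_commute)
  finally have "(\<Sum>d\<in>D. w d * Re (u * (\<psi> d - g))) = 0"
    by (simp only: Re_sum of_real_mult_Re)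
  then have mean0: "(\<Sum>d\<in>D. w d * y d) = 0"
    unfolding y_def by (simp only: mult.left_commute[of _ r] sum_distrib_left[symmetric] mult_zero_right)
  have "(\<Sum>d\<in>D. w d * exp (y d)) \<le> (\<Sum>d\<in>D. w d * (1 + y d + 4 * r\<^sup>2))"
  proof (intro sum_mono mult_left_mono w)
    fix d assume d: "d \<in> D"
    have "(y d)\<^sup>2 \<le> (2 * r)\<^sup>2" using y[OF d] r by (intro abs_le_square_iff[THEN iffD1]) simp
    then show "exp (y d) \<le> 1 + y d + 4 * r\<^sup>2"
      using exp_le_quadratic[of "y d"] y[OF d] r by (simp add: power_mult_distrib)
  qed
  also have "\<dots> = 1 + 4 * r\<^sup>2"
    using mean0 w by (simp add: distrib_left sum.distrib sum_distrib_right[symmetric])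
  also have "\<dots> \<le> exp (4 * r\<^sup>2)" using exp_ge_add_one_self[of "4 * r\<^sup>2"] by simp
  finally show "(\<Sum>d\<in>D. w d * exp (r * Re (u * (\<psi> d - g)))) \<le> exp (4 * r\<^sup>2)"
    by (simp add: y_def)
qed

text \<open>The averaging principle for finite weights; it selects the next term in Maurey's
  method.\<close>

lemma exists_le_weighted_mean:
  fixes w F :: "'d \<Rightarrow> real"
  assumes "finite D" "\<And>d. d \<in> D \<Longrightarrow> 0 \<le> w d" "(\<Sum>d\<in>D. w d) = 1"
    and "(\<Sum>d\<in>D. w d * F d) \<le> b"
  shows "\<exists>d\<in>D. F d \<le> b"
proof (rule ccontr)
  assume "\<not> ?thesis"
  then have gt: "\<And>d. d \<in> D \<Longrightarrow> b < F d" by auto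
  obtain d0 where d0: "d0 \<in> D" "0 < w d0"
    using assms(2,3) by (metis less_eq_real_def sum.neutral zero_neq_one)
  have "(\<Sum>d\<in>D. w d * b) < (\<Sum>d\<in>D. w d * F d)"
    using assms(1,2) d0 gt by (intro sum_strict_mono_ex1) (auto intro!: mult_left_mono bexI[of _ d0] dest: less_imp_le)
  then show False using assms(3,4) by (simp add: sum_distrib_right[symmetric])
qed

text \<open>Reduces the modulus of a complex sum to four real directions, so that real exponential
  moments suffice, at the cost of a factor 2.\<close>

lemma cmod_le_two_directions:
  fixes z :: complex
  shows "\<exists>u\<in>{1,-1,\<i>,-\<i>}. cmod z / 2 \<le> Re (u * z)"
proof -
  have "cmod z \<le> \<bar>Re z\<bar> + \<bar>Im z\<bar>" by (rule cmod_le)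
  then have "cmod z / 2 \<le> \<bar>Re z\<bar> \<or> cmod z / 2 \<le> \<bar>Im z\<bar>" by linarith
  then show ?thesis by (auto simp: abs_if split: if_splits)
qed

text \<open>Maurey's empirical method, derandomised: the terms are chosen one at a time so that an
  exponential moment with respect to both \<open>M\<close> and the uniform measure on the points \<open>\<xi>\<close> stays small.\<close>

lemma (in prob_space) maurey_approximation:
  fixes \<psi> :: "'d \<Rightarrow> 'a \<Rightarrow> complex" and w :: "'d \<Rightarrow> real" and \<xi> :: "nat \<Rightarrow> 'a"
  assumes D: "finite D" and w: "\<And>d. d \<in> D \<Longrightarrow> 0 \<le> w d" "(\<Sum>d\<in>D. w d) = 1"
    and \<psi>: "\<And>d x. d \<in> D \<Longrightarrow> x \<in> space M \<Longrightarrow> cmod (\<psi> d x) \<le> 1"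
    and meas: "\<And>d. d \<in> D \<Longrightarrow> \<psi> d \<in> borel_measurable M"
    and \<xi>: "\<And>\<nu>. \<xi> \<nu> \<in> space M" and m: "0 < m"
    and t: "0 < t" "t \<le> 8"
    and g: "\<And>x. g x = (\<Sum>d\<in>D. complex_of_real (w d) * \<psi> d x)"
  shows "\<exists>ys. set ys \<subseteq> D \<and> length ys = k \<and>
     (let bad = {x \<in> space M. real k * t < cmod ((\<Sum>y\<leftarrow>ys. \<psi> y x) - of_nat k * g x)}
      in bad \<in> events \<and>
         prob bad + real (card {\<nu>. \<nu> < m \<and> \<xi> \<nu> \<in> bad}) / real m \<le> 8 * exp (- (real k * t\<^sup>2 / 64)))"
proof -
  define U :: "complex set" where "U = {1,-1,\<i>,-\<i>}"
  have finU: "finite U" by (simp add: U_def)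
  have U: "cmod u = 1" if "u \<in> U" for u using that by (auto simp: U_def)
  have U4: "card U = 4"
    by (simp add: U_def complex_eq_iff)
  \<comment> \<open>The value \<open>t / 16\<close> minimises \<open>4 * r^2 - r * t / 2\<close>,
    the exponent per term in the Markov bound at the end; the minimum is \<open>- t^2 / 64\<close>.
    The hypothesis \<open>t <= 8\<close> keeps \<open>r <= 1/2\<close>.\<close>
  define r where "r = t / 16"
  have r: "0 \<le> r" "r \<le> 1/2" using t by (auto simp: r_def)
  \<comment> \<open>\<open>T\<close> integrates against the sum of \<open>M\<close> and the
    empirical measure of the points, so that a single choice of terms controls both exceptional
    masses.\<close>
  define T where "T F = expectation F + (\<Sum>\<nu><m. F (\<xi> \<nu>)) / real m" for F :: "'a \<Rightarrow> real"
  define S where "S ys x = (\<Sum>y\<leftarrow>ys. \<psi> y x - g x)" for ys x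
  define P where "P ys x = (\<Sum>u\<in>U. exp (r * Re (u * S ys x)))" for ys x
  have gm: "g \<in> borel_measurable M" 
    unfolding g[abs_def] using meas by simp
  have g1: "cmod (g x) \<le> 1" if "x \<in> space M" for x
    by (rule exp_mean_le(1)[OF w, where \<psi> = "\<lambda>d. \<psi> d x" and u = 1 and r = 0]) (use \<psi> that g in auto)
  have Sm: "S ys \<in> borel_measurable M" if "set ys \<subseteq> D" for ys
    using that meas gm unfolding S_def by (induction ys) auto
  have Sb: "cmod (S ys x) \<le> 2 * real (length ys)" if "set ys \<subseteq> D" "x \<in> space M" for ys x
    using that(1)
  proof (induction ys)
    case (Cons y ys)
    have "cmod (S (y # ys) x) \<le> cmod (\<psi> y x - g x) + cmod (S ys x)"
      by (simp add: S_def norm_triangle_ineq)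
    also have "cmod (\<psi> y x - g x) \<le> 2"
      using norm_triangle_ineq4[of "\<psi> y x" "g x"] \<psi>[of y x] g1[OF that(2)] Cons.prems that(2) by simp
    finally show ?case using Cons by simp
  qed (simp add: S_def)
  have ReS: "Re (u * z) \<le> cmod z" if "u \<in> U" for u z
    using complex_Re_le_cmod[of "u * z"] U[OF that] by (simp add: norm_mult)
  have Em: "(\<lambda>x. exp (r * Re (u * S ys x))) \<in> borel_measurable M" if "set ys \<subseteq> D" for ys u
    using Sm[OF that] by measurable
  have Eint: "integrable M (\<lambda>x. exp (r * Re (u * S ys x)))" if "set ys \<subseteq> D" "u \<in> U" for ys u
  proof (rule integrable_const_bound[where B = "exp (r * (2 * real (length ys)))"])
    show "AE x in M. norm (exp (r * Re (u * S ys x))) \<le> exp (r * (2 * real (length ys)))"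
    proof (rule AE_I2)
      fix x assume x: "x \<in> space M"
      have "Re (u * S ys x) \<le> 2 * real (length ys)"
        using ReS[OF that(2), of "S ys x"] Sb[OF that(1) x] by linarith
      then show "norm (exp (r * Re (u * S ys x))) \<le> exp (r * (2 * real (length ys)))"
        using r by (simp add: mult_left_mono)
    qed
  qed (rule Em[OF that(1)])
  have Pint: "integrable M (P ys)" if "set ys \<subseteq> D" for ys
    unfolding P_def using Eint[OF that] by (intro Bochner_Integration.integrable_sum)
  have Tmono: "T F \<le> T G" if "integrable M F" "integrable M G" "\<And>x. x \<in> space M \<Longrightarrow> F x \<le> G x" for F G
    unfolding T_def using that \<xi> m
    by (intro add_mono integral_mono divide_right_mono sum_mono) auto
  have Tsum: "T (\<lambda>x. \<Sum>d\<in>D. w d * F d x) = (\<Sum>d\<in>D. w d * T (F d))" if "\<And>d. d \<in> D \<Longrightarrow> integrable M (F d)" for F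
  proof -
    have "(\<Sum>\<nu><m. \<Sum>d\<in>D. w d * F d (\<xi> \<nu>)) = (\<Sum>d\<in>D. w d * (\<Sum>\<nu><m. F d (\<xi> \<nu>)))"
      by (subst sum.swap) (simp add: sum_distrib_left)
    then have "(\<Sum>\<nu><m. \<Sum>d\<in>D. w d * F d (\<xi> \<nu>)) / real m = (\<Sum>d\<in>D. w d * ((\<Sum>\<nu><m. F d (\<xi> \<nu>)) / real m))"
      by (simp only: times_divide_eq_right sum_divide_distrib[symmetric])
    then show ?thesis
      unfolding T_def using that by (simp only: distrib_left sum.distrib) simp
  qed
  have Tscale: "T (\<lambda>x. c * F x) = c * T F" for c F
    unfolding T_def by (simp add: distrib_left sum_distrib_left)
  \<comment> \<open>For every \<open>x\<close>, the \<open>w\<close>-average over the appended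
    \<open>d\<close> multiplies the moment by at most \<open>exp (4 * r^2)\<close>; after
    integration some \<open>d\<close> does no worse.\<close>
  have step: "\<exists>d\<in>D. T (P (d # ys)) \<le> exp (4 * r\<^sup>2) * T (P ys)" if ys: "set ys \<subseteq> D" for ys
  proof (rule exists_le_weighted_mean[OF D w])
    have "(\<Sum>d\<in>D. w d * T (P (d # ys))) = T (\<lambda>x. \<Sum>d\<in>D. w d * P (d # ys) x)"
      using Pint ys by (intro Tsum[symmetric]) auto
    also have "\<dots> \<le> T (\<lambda>x. exp (4 * r\<^sup>2) * P ys x)"
    proof (rule Tmono)
      show "integrable M (\<lambda>x. \<Sum>d\<in>D. w d * P (d # ys) x)"
        using Pint ys by (intro Bochner_Integration.integrable_sum integrable_mult_right) auto
      show "integrable M (\<lambda>x. exp (4 * r\<^sup>2) * P ys x)"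
        using Pint[OF ys] by simp
      fix x assume x: "x \<in> space M"
      have "(\<Sum>d\<in>D. w d * P (d # ys) x)
          = (\<Sum>u\<in>U. \<Sum>d\<in>D. w d * exp (r * Re (u * S (d # ys) x)))"
        unfolding P_def by (subst sum.swap) (simp add: sum_distrib_left)
      also have "\<dots> = (\<Sum>u\<in>U. exp (r * Re (u * S ys x)) * (\<Sum>d\<in>D. w d * exp (r * Re (u * (\<psi> d x - g x)))))"
      proof (intro sum.cong refl)
        fix u
        have "r * Re (u * S (d # ys) x) = r * Re (u * S ys x) + r * Re (u * (\<psi> d x - g x))" for d
          by (simp add: S_def algebra_simps)
        then have "w d * exp (r * Re (u * S (d # ys) x))
            = exp (r * Re (u * S ys x)) * (w d * exp (r * Re (u * (\<psi> d x - g x))))" for d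
          by (simp only: exp_add mult_ac)
        then show "(\<Sum>d\<in>D. w d * exp (r * Re (u * S (d # ys) x)))
            = exp (r * Re (u * S ys x)) * (\<Sum>d\<in>D. w d * exp (r * Re (u * (\<psi> d x - g x))))"
          by (simp only: sum_distrib_left)
      qed
      also have "\<dots> \<le> (\<Sum>u\<in>U. exp (r * Re (u * S ys x)) * exp (4 * r\<^sup>2))"
        by (intro sum_mono mult_left_mono exp_mean_le(2) w g U r \<psi> x) auto
      also have "\<dots> = exp (4 * r\<^sup>2) * P ys x" by (simp add: P_def sum_distrib_left mult.commute)
      finally show "(\<Sum>d\<in>D. w d * P (d # ys) x) \<le> exp (4 * r\<^sup>2) * P ys x" .
    qed
    also have "\<dots> = exp (4 * r\<^sup>2) * T (P ys)" by (rule Tscale)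
    finally show "(\<Sum>d\<in>D. w d * T (P (d # ys))) \<le> exp (4 * r\<^sup>2) * T (P ys)" .
  qed
  have "\<exists>ys. set ys \<subseteq> D \<and> length ys = n \<and> T (P ys) \<le> 8 * exp (4 * r\<^sup>2) ^ n" for n
  proof (induction n)
    case 0
    \<comment> \<open>The initial 8 is the total mass 2 of \<open>T\<close> times the four
      directions.\<close>
    show ?case using U4 m by (intro exI[of _ "[]"]) (simp add: T_def P_def S_def prob_space)
  next
    case (Suc n)
    then obtain ys where ys: "set ys \<subseteq> D" "length ys = n" "T (P ys) \<le> 8 * exp (4 * r\<^sup>2) ^ n" by blast
    obtain d where d: "d \<in> D" "T (P (d # ys)) \<le> exp (4 * r\<^sup>2) * T (P ys)" using step[OF ys(1)] by blast
    have "exp (4 * r\<^sup>2) * T (P ys) \<le> exp (4 * r\<^sup>2) * (8 * exp (4 * r\<^sup>2) ^ n)"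
      using ys(3) by (intro mult_left_mono) auto
    then have "T (P (d # ys)) \<le> exp (4 * r\<^sup>2) * (8 * exp (4 * r\<^sup>2) ^ n)" using d(2) by linarith
    then have "T (P (d # ys)) \<le> 8 * exp (4 * r\<^sup>2) ^ Suc n" by simp
    then show ?case using d(1) ys(1,2) by (intro exI[of _ "d # ys"]) simp
  qed
  then obtain ys where ys: "set ys \<subseteq> D" "length ys = k" "T (P ys) \<le> 8 * exp (4 * r\<^sup>2) ^ k" by blast
  define bad where "bad = {x \<in> space M. real k * t < cmod ((\<Sum>y\<leftarrow>ys. \<psi> y x) - of_nat k * g x)}"
  have S_eq: "(\<Sum>y\<leftarrow>ys. \<psi> y x) - of_nat k * g x = S ys x" for x
    unfolding S_def ys(2)[symmetric] by (induction ys) (auto simp: algebra_simps)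
  have bad: "bad \<in> events"
    unfolding bad_def S_eq using Sm[OF ys(1)] by measurable
  \<comment> \<open>Markov's inequality: on \<open>bad\<close> one of the four directions carries at
    least half of the modulus, which exceeds \<open>k * t\<close>.\<close>
  have "T (\<lambda>x. exp (r * (real k * t / 2)) * indicator bad x) \<le> T (P ys)"
  proof (rule Tmono[OF _ Pint[OF ys(1)]])
    show "integrable M (\<lambda>x. exp (r * (real k * t / 2)) * indicator bad x)"
      using bad by (intro integrable_mult_right) (auto simp: less_top[symmetric])
    fix x assume "x \<in> space M"
    show "exp (r * (real k * t / 2)) * indicator bad x \<le> P ys x"
    proof (cases "x \<in> bad")
      case False
      then show ?thesis by (simp add: P_def sum_nonneg)
    next
      case True
      obtain u where u: "u \<in> U" "cmod (S ys x) / 2 \<le> Re (u * S ys x)"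
        using cmod_le_two_directions unfolding U_def by blast
      have "real k * t / 2 \<le> Re (u * S ys x)" using u(2) True by (simp add: bad_def S_eq)
      then have "r * (real k * t / 2) \<le> r * Re (u * S ys x)"
        using r by (intro mult_left_mono)
      then have "exp (r * (real k * t / 2)) \<le> exp (r * Re (u * S ys x))"
        by (simp only: exp_le_cancel_iff)
      also have "\<dots> \<le> P ys x" unfolding P_def using finU u(1) by (intro member_le_sum) auto
      finally show ?thesis using True by simp
    qed
  qed
  then have "exp (r * (real k * t / 2)) * T (indicator bad) \<le> 8 * exp (4 * r\<^sup>2) ^ k"
    unfolding Tscale using ys(3) by linarith
  then have "T (indicator bad) \<le> 8 * exp (4 * r\<^sup>2) ^ k / exp (r * (real k * t / 2))"
    by (simp add: field_simps)
  also have "\<dots> = 8 * exp (real k * (4 * r\<^sup>2) - r * (real k * t / 2))"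
    by (simp add: exp_of_nat_mult exp_diff)
  also have "real k * (4 * r\<^sup>2) - r * (real k * t / 2) = - (real k * t\<^sup>2 / 64)"
    by (simp add: r_def power2_eq_square field_simps)
  finally have "T (indicator bad) \<le> 8 * exp (- (real k * t\<^sup>2 / 64))" .
  moreover have "T (indicator bad) = prob bad + real (card {\<nu>. \<nu> < m \<and> \<xi> \<nu> \<in> bad}) / real m"
  proof -
    have "(\<Sum>\<nu><m. indicator bad (\<xi> \<nu>)) = real (card {\<nu>. \<nu> < m \<and> \<xi> \<nu> \<in> bad})"
    proof -
      have "(\<Sum>\<nu><m. indicat_real bad (\<xi> \<nu>)) = (\<Sum>\<nu>\<in>{\<nu>\<in>{..<m}. \<xi> \<nu> \<in> bad}. 1)"
        by (subst sum.inter_filter) (auto simp: indicator_def of_bool_def intro!: sum.cong)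
      then show ?thesis by simp
    qed
    then show ?thesis unfolding T_def using bad by simp
  qed
  ultimately show ?thesis
    using ys(1,2) bad unfolding bad_def Let_def by (intro exI[of _ ys]) simp
qed

subsection \<open>Discretisation of the dictionary\<close>

text \<open>Values below 1/2 are absorbed by the constant 1/4. Otherwise the largest level
  \<open>j\<close> with \<open>2^j / 2 <= y\<close> has \<open>y <= 2^j\<close>, by maximality or,
  if \<open>j = n\<close>, by hypothesis, and the single term \<open>4^j\<close> suffices.\<close>

lemma dyadic_layers:
  fixes y :: real
  assumes "0 \<le> y" "y \<le> 2^n"
  shows "y\<^sup>2 \<le> 1/4 + (\<Sum>i\<le>n. 4^i * of_bool (2^i / 2 \<le> y))"
proof (cases "y < 1/2")
  case True
  have "y\<^sup>2 \<le> (1/2)\<^sup>2" using assms True by (intro power_mono) auto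
  moreover have "0 \<le> (\<Sum>i\<le>n. 4^i * of_bool (2^i / 2 \<le> y) :: real)" by (intro sum_nonneg) auto
  ultimately show ?thesis by (simp add: power2_eq_square)
next
  case False
  define j where "j = (GREATEST i. i \<le> n \<and> 2^i / 2 \<le> y)"
  have j: "j \<le> n \<and> 2^j / 2 \<le> y" unfolding j_def
    by (rule GreatestI_nat[of _ 0 n]) (use False in auto)
  have "y \<le> 2^j"
  proof (rule ccontr)
    assume "\<not> y \<le> 2^j"
    then have "2^Suc j / 2 \<le> y" and "j \<noteq> n" using assms by auto
    then have "Suc j \<le> j" unfolding j_def using j
      by (intro Greatest_le_nat[of _ _ n]) (auto simp: j_def)
    then show False by simp
  qed
  then have "y\<^sup>2 \<le> (2^j)\<^sup>2" using assms by (intro power_mono) auto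
  also have "\<dots> = 4^j" by (simp add: power2_eq_square flip: power_mult_distrib)
  also have "\<dots> = 4^j * of_bool (2^j / 2 \<le> y)" using j by simp
  also have "\<dots> \<le> (\<Sum>i\<le>n. 4^i * of_bool (2^i / 2 \<le> y) :: real)"
    using j by (intro member_le_sum) auto
  finally show ?thesis by simp
qed

text \<open>Pigeonhole on the integrated layer bound: if all \<open>n + 1\<close> levels were
  lighter, the second moment would be less than \<open>1/4 + 3/4\<close>.\<close>

lemma (in prob_space) heavy_dyadic_level:
  fixes g :: "'a \<Rightarrow> complex"
  assumes meas: "g \<in> borel_measurable M" and b: "\<And>x. x \<in> space M \<Longrightarrow> cmod (g x) \<le> 2^n"
    and norm: "expectation (\<lambda>x. (cmod (g x))\<^sup>2) = 1"
  shows "\<exists>i\<le>n. 3 / (4 * (real n + 1) * 4^i) \<le> prob {x \<in> space M. 2^i / 2 \<le> cmod (g x)}"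
proof (rule ccontr)
  define E where "E i = {x \<in> space M. 2^i / 2 \<le> cmod (g x)}" for i :: nat
  have E: "E i \<in> events" for i unfolding E_def using meas by measurable
  assume "\<not> ?thesis"
  then have small0: "prob (E i) < 3 / (4 * (real n + 1) * 4^i)" if "i \<le> n" for i
    using that unfolding E_def not_le[symmetric] by blast
  have small: "4^i * prob (E i) < 3 / (4 * (real n + 1))" if "i \<le> n" for i
  proof -
    have "b * y < 3 / a" if "y < 3 / (a * b)" "0 < a" "0 < b" for a b y :: real
      using that by (simp add: field_simps)
    then show ?thesis using \<open>i \<le> n\<close> small0[of i] by simp
  qed
  have ind: "integrable M (indicat_real (E i))" for i
    using E by (auto simp: less_top[symmetric])
  have "expectation (\<lambda>x. (cmod (g x))\<^sup>2) \<le> expectation (\<lambda>x. 1/4 + (\<Sum>i\<le>n. 4^i * indicat_real (E i) x))"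
  proof (rule integral_mono)
    \<comment> \<open>A non-integrable function has integral 0 by convention, so the value 1 forces
      integrability.\<close>
    show "integrable M (\<lambda>x. (cmod (g x))\<^sup>2)"
      using norm not_integrable_integral_eq by fastforce
    show "integrable M (\<lambda>x. 1/4 + (\<Sum>i\<le>n. 4^i * indicat_real (E i) x))"
      using ind by (intro Bochner_Integration.integrable_add Bochner_Integration.integrable_sum
          integrable_mult_right) auto
    fix x assume x: "x \<in> space M"
    have "indicat_real (E i) x = of_bool (2^i / 2 \<le> cmod (g x))" for i
      using x by (simp add: E_def indicator_def)
    then show "(cmod (g x))\<^sup>2 \<le> 1/4 + (\<Sum>i\<le>n. 4^i * indicat_real (E i) x)"
      using dyadic_layers[OF norm_ge_zero b[OF x]] by simp
  qed
  also have "\<dots> = 1/4 + (\<Sum>i\<le>n. 4^i * prob (E i))"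
  proof -
    have "integrable M (\<lambda>x. \<Sum>i\<le>n. 4^i * indicat_real (E i) x)"
      using ind by (intro Bochner_Integration.integrable_sum integrable_mult_right)
    moreover have "expectation (\<lambda>x. \<Sum>i\<le>n. 4^i * indicat_real (E i) x) = (\<Sum>i\<le>n. 4^i * prob (E i))"
      using ind E by (subst Bochner_Integration.integral_sum) auto
    ultimately show ?thesis
      by (subst Bochner_Integration.integral_add) (simp_all only: integrable_const lebesgue_integral_const prob_space scaleR_one)
  qed
  also have "(\<Sum>i\<le>n. 4^i * prob (E i)) < (\<Sum>i\<le>n. 3 / (4 * (real n + 1)))"
    using small by (intro sum_strict_mono) auto
  finally show False using norm by (simp add: field_simps)
qed

text \<open>The events to be hit involve only the finitely many averages \<open>h ys\<close>, so the
  points are fixed before \<open>g\<close> is known, while the average approximating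
  \<open>g\<close> is chosen afterwards and may depend on the points. Its large level set is hit
  more often than \<open>bad\<close>; hence some point lies in that set and outside
  \<open>bad\<close>, and there \<open>g\<close> is large too.\<close>

lemma (in prob_space) sampling_convex_hull:
  fixes \<psi> :: "'d \<Rightarrow> 'a \<Rightarrow> complex" and k :: "nat \<Rightarrow> nat"
  assumes D: "finite D" "D \<noteq> {}"
    and \<psi>: "\<And>d x. d \<in> D \<Longrightarrow> x \<in> space M \<Longrightarrow> cmod (\<psi> d x) \<le> 1"
    and meas: "\<And>d. d \<in> D \<Longrightarrow> \<psi> d \<in> borel_measurable M"
    and m: "0 < m" and B: "2^n \<le> B" and k: "\<And>i. i \<le> n \<Longrightarrow> 0 < k i"
    and tail: "\<And>i. i \<le> n \<Longrightarrow>
       8 * exp (- (real (k i) * (2^i / (8 * B))\<^sup>2 / 64)) \<le> 3 / (32 * (real n + 1) * 4^i)"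
    and large: "\<And>i. i \<le> n \<Longrightarrow>
       real (k i) * ln (card D) + ln (real n + 1) < real m * (15 / (64 * (real n + 1) * 4^i))"
  shows "\<exists>\<xi>::nat \<Rightarrow> 'a. (\<forall>\<nu>. \<xi> \<nu> \<in> space M) \<and>
     (\<forall>w g. (\<forall>d\<in>D. 0 \<le> w d) \<longrightarrow> (\<Sum>d\<in>D. w d) = 1 \<longrightarrow>
        (\<forall>x. g x = complex_of_real B * (\<Sum>d\<in>D. complex_of_real (w d) * \<psi> d x)) \<longrightarrow>
        (\<forall>x\<in>space M. cmod (g x) \<le> 2^n) \<longrightarrow> expectation (\<lambda>x. (cmod (g x))\<^sup>2) = 1 \<longrightarrow>
        (\<exists>\<nu><m. 1/4 \<le> cmod (g (\<xi> \<nu>))))"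
proof -
  have B0: "0 < B" using B by (smt (verit) zero_less_power)
  define Y where "Y i = {ys. set ys \<subseteq> D \<and> length ys = k i}" for i
  have Y: "finite (Y i)" "card (Y i) = card D ^ k i" for i
    unfolding Y_def using D by (auto intro: finite_lists_length_eq card_lists_length_eq)
  have cD: "0 < card D" using D by (simp add: card_gt_0_iff)
  define h where "h ys x = complex_of_real (B / length ys) * (\<Sum>y\<leftarrow>ys. \<psi> y x)" for ys x
  have hm: "h ys \<in> borel_measurable M" if "set ys \<subseteq> D" for ys
  proof -
    have "(\<lambda>x. \<Sum>y\<leftarrow>ys. \<psi> y x) \<in> borel_measurable M"
      using that meas by (induction ys) auto
    then show ?thesis unfolding h_def[abs_def] by simp
  qed
  \<comment> \<open>\<open>3/8 = 1/2 - 1/8\<close>: the level of \<open>g\<close> minus the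
    approximation error, both in units of \<open>2^i\<close>.\<close>
  define E where "E p = {x \<in> space M. 3/8 * 2^fst p \<le> cmod (h (snd p) x)}" for p :: "nat \<times> 'd list"
  \<comment> \<open>Uniform over the \<open>n + 1\<close> levels and, within level \<open>i\<close>,
    over its \<open>card D ^ k i\<close> lists, so the weights sum to 1; \<open>- ln (c p)\<close>
    is the left-hand side of \<open>large\<close>.\<close>
  define c where "c p = 1 / ((real n + 1) * real (card D) ^ k (fst p))" for p :: "nat \<times> 'd list"
  have "\<exists>\<xi>::nat \<Rightarrow> 'a. (\<forall>\<nu>. \<xi> \<nu> \<in> space M) \<and>
      (\<forall>p\<in>Sigma {..n} Y. real m * prob (E p) / 2 + ln (c p) \<le> real (card {\<nu>. \<nu> < m \<and> \<xi> \<nu> \<in> E p}))"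
  proof (rule points_hitting_events)
    show "finite (Sigma {..n} Y)" using Y by auto
    show "0 < c p" for p unfolding c_def using cD by simp
    have "(\<Sum>p\<in>Sigma {..n} Y. c p) = (\<Sum>i\<le>n. \<Sum>ys\<in>Y i. c (i, ys))"
      using Y by (subst sum.Sigma) auto
    also have "\<dots> = (\<Sum>i\<le>n. 1 / (real n + 1))"
      unfolding c_def using Y cD by (intro sum.cong) auto
    also have "\<dots> = 1" by (simp add: add_ac)
    finally show "(\<Sum>p\<in>Sigma {..n} Y. c p) \<le> 1" by simp
    show "E p \<in> events" if "p \<in> Sigma {..n} Y" for p
      unfolding E_def using that hm by (auto simp: Y_def)
  qed
  then obtain \<xi> :: "nat \<Rightarrow> 'a" where \<xi>: "\<And>\<nu>. \<xi> \<nu> \<in> space M" and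
    hits: "\<And>i ys. i \<le> n \<Longrightarrow> ys \<in> Y i \<Longrightarrow>
       real m * prob (E (i, ys)) / 2 + ln (c (i, ys)) \<le> real (card {\<nu>. \<nu> < m \<and> \<xi> \<nu> \<in> E (i, ys)})"
    by (force)
  have "\<exists>\<nu><m. 1/4 \<le> cmod (g (\<xi> \<nu>))"
    if w: "\<forall>d\<in>D. 0 \<le> w d" "(\<Sum>d\<in>D. w d) = 1"
      and g: "\<forall>x. g x = complex_of_real B * (\<Sum>d\<in>D. complex_of_real (w d) * \<psi> d x)"
      and gb: "\<forall>x\<in>space M. cmod (g x) \<le> 2^n" and gn: "expectation (\<lambda>x. (cmod (g x))\<^sup>2) = 1"
    for w g
  proof -
    have gm: "g \<in> borel_measurable M"
    proof -
      have "(\<lambda>x. complex_of_real B * (\<Sum>d\<in>D. complex_of_real (w d) * \<psi> d x)) \<in> borel_measurable M"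
        using meas by simp
      also have "(\<lambda>x. complex_of_real B * (\<Sum>d\<in>D. complex_of_real (w d) * \<psi> d x)) = g"
        using g by auto
      finally show ?thesis .
    qed
    define p where "p i = 3 / (4 * (real n + 1) * 4^i)" for i :: nat
    define G where "G i = {x \<in> space M. 2^i / 2 \<le> cmod (g x)}" for i :: nat
    obtain i where i: "i \<le> n" "p i \<le> prob (G i)"
      using heavy_dyadic_level[OF gm _ gn, of n] gb unfolding p_def G_def by blast
    \<comment> \<open>Chosen so that \<open>B * t = 2^i / 8\<close>, the desired error after scaling
      by \<open>B\<close>.\<close>
    define t where "t = 2^i / (8 * B)"
    have "(2::real)^i \<le> 2^n" using i by simp
    then have "2^i \<le> 64 * B" using B B0 by linarith
    then have t: "0 < t" "t \<le> 8" using B0 by (auto simp: t_def field_simps)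
    have "\<exists>ys bad. set ys \<subseteq> D \<and> length ys = k i \<and> bad = {x \<in> space M. real (k i) * t <
         cmod ((\<Sum>y\<leftarrow>ys. \<psi> y x) - of_nat (k i) * (\<Sum>d\<in>D. complex_of_real (w d) * \<psi> d x))} \<and>
       bad \<in> events \<and>
       prob bad + real (card {\<nu>. \<nu> < m \<and> \<xi> \<nu> \<in> bad}) / real m \<le> 8 * exp (- (real (k i) * t\<^sup>2 / 64))"
      using maurey_approximation[of D w \<psi> \<xi> m t "\<lambda>x. \<Sum>d\<in>D. complex_of_real (w d) * \<psi> d x" "k i",
        OF D(1) w(1)[rule_format] w(2) \<psi> meas \<xi> m t refl]
      unfolding Let_def by blast
    then obtain ys bad where ys: "set ys \<subseteq> D" "length ys = k i"
      and bad_def: "bad = {x \<in> space M. real (k i) * t <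
         cmod ((\<Sum>y\<leftarrow>ys. \<psi> y x) - of_nat (k i) * (\<Sum>d\<in>D. complex_of_real (w d) * \<psi> d x))}"
      and bad: "bad \<in> events"
        "prob bad + real (card {\<nu>. \<nu> < m \<and> \<xi> \<nu> \<in> bad}) / real m \<le> 8 * exp (- (real (k i) * t\<^sup>2 / 64))"
      by blast
    have close: "cmod (h ys x - g x) \<le> 2^i / 8" if "x \<in> space M" "x \<notin> bad" for x
    proof -
      let ?z = "(\<Sum>y\<leftarrow>ys. \<psi> y x) - of_nat (k i) * (\<Sum>d\<in>D. complex_of_real (w d) * \<psi> d x)"
      have "h ys x - g x = complex_of_real (B / k i) * ?z"
        using k[OF i(1)] g ys(2) by (simp add: h_def field_simps)
      then have "cmod (h ys x - g x) = B / k i * cmod ?z"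
        using B0 by (simp only: norm_mult norm_of_real) simp
      also have "\<dots> \<le> B / k i * (real (k i) * t)"
        using that B0 by (intro mult_left_mono) (auto simp: bad_def)
      also have "\<dots> = 2^i / 8" using k[OF i(1)] B0 by (simp add: t_def)
      finally show ?thesis .
    qed
    have bad_le: "prob bad + real (card {\<nu>. \<nu> < m \<and> \<xi> \<nu> \<in> bad}) / real m \<le> p i / 8"
    proof -
      have "p i / 8 = 3 / (32 * (real n + 1) * 4^i)" by (simp add: p_def field_simps)
      then show ?thesis using bad(2) tail[OF i(1)] unfolding t_def by linarith
    qed
    have pb: "prob bad \<le> p i / 8" using bad_le m
      by (smt (verit) divide_nonneg_nonneg of_nat_0_le_iff)
    have "real (card {\<nu>. \<nu> < m \<and> \<xi> \<nu> \<in> bad}) / real m \<le> p i / 8"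
      using bad_le measure_nonneg[of M bad] by linarith
    then have cb: "real (card {\<nu>. \<nu> < m \<and> \<xi> \<nu> \<in> bad}) \<le> real m * (p i / 8)"
      using m by (simp add: field_simps)
    have Ge: "G i \<in> events" unfolding G_def using gm by measurable
    have Ee: "E (i, ys) \<in> events" unfolding E_def using hm[OF ys(1)] by simp
    have "G i - bad \<subseteq> E (i, ys)"
    proof
      fix x assume x: "x \<in> G i - bad"
      then have "cmod (h ys x - g x) \<le> 2^i / 8" "2^i / 2 \<le> cmod (g x)" 
        using close by (auto simp: G_def)
      moreover have "cmod (g x) \<le> cmod (h ys x) + cmod (h ys x - g x)"
        using norm_triangle_sub[of "g x" "h ys x"] by (simp add: norm_minus_commute)
      ultimately show "x \<in> E (i, ys)" using x by (auto simp: E_def G_def)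
    qed
    then have "prob (G i - bad) \<le> prob (E (i, ys))" using Ee by (intro finite_measure_mono)
    moreover have "prob (G i) \<le> prob (G i - bad) + prob bad"
    proof -
      have "prob (G i) \<le> prob ((G i - bad) \<union> bad)"
        using Ge bad(1) by (intro finite_measure_mono) auto
      also have "\<dots> \<le> prob (G i - bad) + prob bad"
        using Ge bad(1) by (intro measure_Un_le) auto
      finally show ?thesis .
    qed
    ultimately have pE: "7/8 * p i \<le> prob (E (i, ys))" using i(2) pb by linarith
    have "ln (c (i, ys)) = - (real (k i) * ln (card D) + ln (real n + 1))"
      using cD by (simp add: c_def ln_div ln_mult ln_realpow)
    then have "real m * (7/16 * p i) - (real (k i) * ln (card D) + ln (real n + 1))
        \<le> real (card {\<nu>. \<nu> < m \<and> \<xi> \<nu> \<in> E (i, ys)})"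
      using hits[of i ys] i(1) ys pE mult_left_mono[OF pE, of "real m"] by (auto simp: Y_def)
    moreover have "real m * (15 / (64 * (real n + 1) * 4^i)) = real m * (5/16 * p i)"
      by (simp add: p_def)
    moreover have "real m * (7/16 * p i) = real m * (5/16 * p i) + real m * (p i / 8)"
      by (simp add: algebra_simps)
    ultimately have "real (card {\<nu>. \<nu> < m \<and> \<xi> \<nu> \<in> bad}) < real (card {\<nu>. \<nu> < m \<and> \<xi> \<nu> \<in> E (i, ys)})"
      using large[OF i(1)] cb by linarith
    then have "\<not> {\<nu>. \<nu> < m \<and> \<xi> \<nu> \<in> E (i, ys)} \<subseteq> {\<nu>. \<nu> < m \<and> \<xi> \<nu> \<in> bad}"
      using card_mono[of "{\<nu>. \<nu> < m \<and> \<xi> \<nu> \<in> bad}" "{\<nu>. \<nu> < m \<and> \<xi> \<nu> \<in> E (i, ys)}"] by fastforce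
    then obtain \<nu> where \<nu>: "\<nu> < m" "\<xi> \<nu> \<in> E (i, ys)" "\<xi> \<nu> \<notin> bad" by blast
    have "cmod (h ys (\<xi> \<nu>)) \<le> cmod (g (\<xi> \<nu>)) + cmod (h ys (\<xi> \<nu>) - g (\<xi> \<nu>))"
      using norm_triangle_sub[of "h ys (\<xi> \<nu>)" "g (\<xi> \<nu>)"] by simp
    moreover have "3/8 * 2^i \<le> cmod (h ys (\<xi> \<nu>))" using \<nu> by (simp add: E_def)
    ultimately have "2^i / 4 \<le> cmod (g (\<xi> \<nu>))" using close[OF \<xi> \<nu>(3)] by linarith
    moreover have "(1::real) \<le> 2^i" by simp
    ultimately show ?thesis using \<nu>(1) by (intro exI[of _ \<nu>]) linarith
  qed
  then show ?thesis using \<xi> by blast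
qed

text \<open>The index \<open>0\<close> stands for the zero function and takes up the slack in the total weight.\<close>

lemma four_phase_combination:
  fixes a :: "nat \<Rightarrow> complex"
  assumes B: "0 < B" and a: "(\<Sum>j=1..N. \<bar>Re (a j)\<bar> + \<bar>Im (a j)\<bar>) \<le> B"
  shows "\<exists>w :: nat \<times> nat \<Rightarrow> real. (\<forall>d\<in>{0..N} \<times> {..<4}. 0 \<le> w d) \<and> (\<Sum>d\<in>{0..N} \<times> {..<4}. w d) = 1 \<and>
     (\<forall>f. (\<Sum>j=1..N. a j * f j) = complex_of_real B *
        (\<Sum>d\<in>{0..N} \<times> {..<4}. complex_of_real (w d) * (if fst d = 0 then 0 else \<i> ^ snd d * f (fst d))))"
proof -
  define S where "S = (\<Sum>j=1..N. \<bar>Re (a j)\<bar> + \<bar>Im (a j)\<bar>)"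
  \<comment> \<open>For nonzero \<open>j\<close> the four phases receive the positive parts of
    \<open>Re (a j)\<close>, \<open>Im (a j)\<close>, \<open>- Re (a j)\<close> and
    \<open>- Im (a j)\<close>, divided by \<open>B\<close>.\<close>
  define w :: "nat \<times> nat \<Rightarrow> real" where "w d = (if fst d = 0 then (if snd d = 0 then 1 - S / B else 0)
     else max 0 (Re (cnj (\<i> ^ snd d) * a (fst d))) / B)" for d
  have l4: "{..<4::nat} = {0,1,2,3}" by auto
  have w0: "(\<Sum>l<4. w (0, l)) = 1 - S / B" by (simp add: l4 w_def)
  have wj: "(\<Sum>l<4. w (j, l)) = (\<bar>Re (a j)\<bar> + \<bar>Im (a j)\<bar>) / B" if "j \<noteq> 0" for j
    using that by (simp add: l4 w_def power2_eq_square power3_eq_cube max_def add_divide_distrib diff_divide_distrib)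
  have wa: "complex_of_real B * (\<Sum>l<4. complex_of_real (w (j, l)) * \<i> ^ l) = a j" if "j \<noteq> 0" for j
    using that B by (simp add: l4 w_def power2_eq_square power3_eq_cube max_def complex_eq_iff)
  have split: "(\<Sum>d\<in>{0..N} \<times> {..<4}. F d) = (\<Sum>l<4. F (0, l)) + (\<Sum>j=1..N. \<Sum>l<4. F (j, l))"
    for F :: "nat \<times> nat \<Rightarrow> 'b::comm_monoid_add"
  proof -
    have "(\<Sum>d\<in>{0..N} \<times> {..<4}. F d) = (\<Sum>j=0..N. \<Sum>l<4. F (j, l))"
      by (simp add: sum.cartesian_product)
    then show ?thesis by (simp add: sum.atLeast_Suc_atMost)
  qed
  show ?thesis
  proof (intro exI[of _ w] conjI allI ballI)
    have "S / B \<le> 1" using a B by (simp add: S_def)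
    then show "0 \<le> w d" for d using B by (simp add: w_def)
    have "(\<Sum>j=1..N. \<Sum>l<4. w (j, l)) = S / B"
      unfolding S_def sum_divide_distrib by (intro sum.cong refl wj) auto
    then show "(\<Sum>d\<in>{0..N} \<times> {..<4}. w d) = 1" unfolding split w0 by simp
    fix f :: "nat \<Rightarrow> complex"
    have "(\<Sum>j=1..N. a j * f j) = (\<Sum>j=1..N. (complex_of_real B * (\<Sum>l<4. complex_of_real (w (j, l)) * \<i> ^ l)) * f j)"
      by (intro sum.cong refl) (simp only: wa not_one_le_zero atLeastAtMost_iff, metis not_one_le_zero wa)
    also have "\<dots> = complex_of_real B * (\<Sum>j=1..N. \<Sum>l<4. complex_of_real (w (j, l)) * (\<i> ^ l * f j))"
      by (simp add: sum_distrib_left sum_distrib_right mult_ac)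
    finally show "(\<Sum>j=1..N. a j * f j) = complex_of_real B *
        (\<Sum>d\<in>{0..N} \<times> {..<4}. complex_of_real (w d) * (if fst d = 0 then 0 else \<i> ^ snd d * f (fst d)))"
      unfolding split by simp
  qed
qed

section \<open>Choice of the numerical parameters\<close>

text \<open>Rounding \<open>log 4 M\<close> up; the natural logarithm bounds it because
  \<open>ln 4 >= 1\<close>. With this \<open>n\<close> the dyadic levels reach \<open>sqrt M\<close>
  while \<open>2^n\<close> is at most \<open>2 * sqrt M\<close>.\<close>

lemma ex_power4_between:
  fixes M :: real
  assumes "1 \<le> M"
  shows "\<exists>n::nat. M \<le> 4^n \<and> 4^n \<le> 4 * M \<and> real n \<le> ln M + 1"
proof -
  define n where "n = nat \<lceil>log 4 M\<rceil>"
  have l0: "0 \<le> log 4 M" using assms by simp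
  then have n: "log 4 M \<le> real n" "real n \<le> log 4 M + 1"
    unfolding n_def by linarith+
  have p: "4 powr real n = 4^n" by (simp add: powr_realpow)
  have "M = 4 powr (log 4 M)" using assms by simp
  also have "\<dots> \<le> 4 powr real n" using n by (intro powr_mono) auto
  finally have 1: "M \<le> 4^n" using p by simp
  have "4 powr real n \<le> 4 powr (log 4 M + 1)" using n by (intro powr_mono) auto
  also have "\<dots> = 4 * M" using assms by (simp add: powr_add)
  finally have 2: "4^n \<le> 4 * M" using p by simp
  have "ln (4::real) = 2 * ln 2" using ln_realpow[of "2::real" 2] by simp
  then have "1 \<le> ln (4::real)" using ln2_ge_two_thirds by linarith
  then have "log 4 M \<le> ln M" using assms unfolding log_def
    by (simp add: divide_le_eq mult_le_cancel_left1)
  then show ?thesis using 1 2 n by (intro exI[of _ n]) linarith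
qed

text \<open>The constant \<open>81920 = 5 * 64 * 256\<close> makes the exponent at least
  \<open>5 * (n + 1)\<close>. The right-hand side is then absorbed by
  \<open>exp 5 >= 97 > 256/3\<close> and \<open>(n + 1) * 4^i <= 2^n * 4^n = 8^n\<close>.\<close>

lemma maurey_tail_bound:
  fixes M :: real
  assumes M: "1 \<le> M" and i: "i \<le> n" and k: "81920 * M * (real n + 1) / 4^i \<le> k"
  shows "8 * exp (- (k * (2^i / (8 * (2 * sqrt M)))\<^sup>2 / 64)) \<le> 3 / (32 * (real n + 1) * 4^i)"
proof -
  have "(2^i / (8 * (2 * sqrt M)))\<^sup>2 = 4^i / (256 * M)"
    using M by (simp add: power_divide power_mult_distrib power2_eq_square flip: power_mult_distrib)
  moreover have "5 * (real n + 1) \<le> k * (4^i / (256 * M)) / 64"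
    using k M by (simp add: field_simps)
  ultimately have "exp (- (k * (2^i / (8 * (2 * sqrt M)))\<^sup>2 / 64)) \<le> exp (- (5 * (real n + 1)))"
    by simp
  moreover have "256 * (real n + 1) * 4^i / 3 \<le> exp (5 * (real n + 1))"
  proof -
    have e5: "97 \<le> exp (5::real)"
    proof -
      have "(5/2)^5 \<le> (exp 1::real)^5"
        using exp_lower_Taylor_quadratic[of 1] by (intro power_mono) auto
      also have "\<dots> = exp 5" by (simp add: exp_of_nat_mult[symmetric])
      finally show ?thesis by (simp add: power_divide)
    qed
    have "real n + 1 \<le> 2^n"
      by (induction n) auto
    moreover have "(4::real)^i \<le> 4^n" using i by simp
    ultimately have "(real n + 1) * 4^i \<le> 2^n * 4^n"
      using mult_mono[of "real n + 1" "2^n" "4^i" "4^n::real"] by (simp add: algebra_simps)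
    then have "256 / 3 * ((real n + 1) * 4^i) \<le> 97 * (2^n * 4^n)" by (rule mult_mono[rotated]) auto
    moreover have "256 * (real n + 1) * 4^i / 3 = 256 / 3 * ((real n + 1) * 4^i)"
      by (simp add: field_simps)
    ultimately have "256 * (real n + 1) * 4^i / 3 \<le> 97 * (2^n * 4^n)" by linarith
    also have "\<dots> = 97 * 8^n" by (simp flip: power_mult_distrib)
    also have "\<dots> \<le> exp 5 * exp 5 ^ n" using e5 by (intro mult_mono power_mono) auto
    also have "\<dots> = exp (5 * (real n + 1))"
      by (simp add: exp_of_nat_mult[symmetric] exp_add[symmetric] algebra_simps)
    finally show ?thesis .
  qed
  then have "exp (- (5 * (real n + 1))) \<le> 3 / (256 * (real n + 1) * 4^i)"
    using le_imp_inverse_le[of "256 * (real n + 1) * 4^i / 3" "exp (5 * (real n + 1))"]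
    by (simp only: exp_minus inverse_divide) simp
  ultimately have le: "exp (- (k * (2^i / (8 * (2 * sqrt M)))\<^sup>2 / 64)) \<le> 3 / (256 * (real n + 1) * 4^i)"
    by (rule order_trans)
  have "8 * exp (- (k * (2^i / (8 * (2 * sqrt M)))\<^sup>2 / 64)) \<le> 8 * (3 / (256 * (real n + 1) * 4^i))"
    using le by (rule mult_left_mono) simp
  also have "\<dots> = 3 / (32 * (real n + 1) * 4^i)"
  proof -
    have "8 * (3 / (256 * x * y)) = 3 / (32 * x * y)" if "0 < x" "0 < y" for x y :: real
      using that by (simp add: field_simps)
    from this[of "real n + 1" "4^i"] show ?thesis by (auto simp only: zero_less_power zero_less_numeral of_nat_0_le_iff add_nonneg_pos zero_less_one)
  qed
  finally show ?thesis .
qed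

text \<open>All terms are compared with \<open>x * ln N\<close>. The rounding of \<open>k\<close>
  costs at most \<open>4 * x\<close>, and \<open>4 * (N + 1) <= 8 * N\<close> bounds the entropy per
  term by \<open>4 * ln N\<close>. The total \<open>4 * 81924 + 8 = 327704\<close> stays below
  \<open>1500000 * 15 / 64\<close>.\<close>

lemma sample_size_bound:
  fixes M :: real and N m i n :: nat
  assumes M: "1 \<le> M" and N: "2 \<le> N" and i: "4^i \<le> 4 * M"
    and k: "k \<le> 81920 * M * (real n + 1) / 4^i + 1"
    and m: "1500000 * M * (real n + 1)\<^sup>2 * ln N \<le> m"
  shows "k * ln (4 * (real N + 1)) + ln (real n + 1) < m * (15 / (64 * (real n + 1) * 4^i))"
proof -
  have lnN: "ln 2 \<le> ln (real N)" using N by simp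
  have l2: "1/2 \<le> ln (2::real)" using ln2_ge_two_thirds by linarith
  define x where "x = M * (real n + 1) / 4^i"
  have x: "real n + 1 \<le> 4 * x"
    using mult_left_mono[OF i, of "real n + 1"] by (simp add: x_def field_simps)
  have kx: "k \<le> 81924 * x"
    using k x by (simp add: x_def)
  have "ln (4 * (real N + 1)) \<le> ln (2^3 * real N)" using N by (subst ln_le_cancel_iff) auto
  also have "\<dots> = 3 * ln 2 + ln N" using N by (simp only: ln_mult ln_realpow) simp
  also have "\<dots> \<le> 4 * ln N" using lnN by simp
  finally have lD: "ln (4 * (real N + 1)) \<le> 4 * ln N" .
  have "0 \<le> ln (4 * (real N + 1))" by simp
  then have "k * ln (4 * (real N + 1)) \<le> (81924 * x) * (4 * ln N)"
    using kx lD x by (intro mult_mono) auto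
  moreover have "ln (real n + 1) \<le> 8 * x * ln N"
  proof -
    have "ln (real n + 1) \<le> real n + 1" using ln_le_minus_one[of "real n + 1"] by simp
    also note x
    also have "4 * x \<le> 4 * x * (2 * ln N)" using x lnN l2 by (simp add: mult_le_cancel_left1)
    finally show ?thesis by simp
  qed
  ultimately have "k * ln (4 * (real N + 1)) + ln (real n + 1) \<le> 327704 * (x * ln N)"
    by (simp add: algebra_simps)
  also have "\<dots> < 1500000 * 15 / 64 * (x * ln N)"
    using x lnN l2 by (intro mult_strict_right_mono mult_pos_pos) auto
  also have "\<dots> = (1500000 * M * (real n + 1)\<^sup>2 * ln N) * (15 / (64 * (real n + 1) * 4^i))"
  proof -
    have "1500000 * 15 / 64 * (M * q / P * ln N) = (1500000 * M * q\<^sup>2 * ln N) * (15 / (64 * q * P))"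
      if "q \<noteq> 0" "P \<noteq> 0" for q P :: real
      using that by (simp add: field_simps power2_eq_square)
    from this[of "real n + 1" "4^i"] show ?thesis unfolding x_def by simp
  qed
  also have "\<dots> \<le> m * (15 / (64 * (real n + 1) * 4^i))"
    using m by (intro mult_right_mono) auto
  finally show ?thesis .
qed

text \<open>Since \<open>l = ln (2 * v)\<close> is at least 2/3,
  \<open>n + 1 <= ln K + l + 2 <= (2 * ln K + 5) * l\<close>, which produces the squared logarithm.
  The last factor in the bound on \<open>m\<close> is at least 1/6, and
  \<open>6 * 1500000 <= 10^7\<close>.\<close>

lemma level_count_bound:
  assumes K: "1 \<le> K" and v: "1 \<le> v" and N: "2 \<le> N" and n: "real n \<le> ln (K * real v) + 1"
    and m: "10^7 * K * (2 * ln K + 5)\<^sup>2 * real v * ln (real N) * (ln (2 * real v))^2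
        * (ln (2 * real v) + ln (ln (real N))) \<le> m"
  shows "1500000 * (K * real v) * (real n + 1)\<^sup>2 * ln N \<le> m"
proof -
  define l where "l = ln (2 * real v)"
  have l: "2/3 \<le> l"
    using ln2_ge_two_thirds v ln_le_cancel_iff[of 2 "2 * real v"] unfolding l_def by linarith
  have lnN: "2/3 \<le> ln (real N)" using ln2_ge_two_thirds N ln_le_cancel_iff[of 2 "real N"] by linarith
  \<comment> \<open>At \<open>N = 2\<close> the term \<open>ln (ln N)\<close> is negative; it is at
    least \<open>ln (2/3) >= -1/2\<close>, and \<open>2/3 - 1/2 = 1/6\<close>.\<close>
  have "ln (3/2::real) \<le> 1/2" using ln_le_minus_one[of "3/2::real"] by simp
  moreover have "ln (2/3::real) = - ln (3/2)" by (simp add: ln_div)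
  moreover have "ln (2/3) \<le> ln (ln (real N))" using lnN by (subst ln_le_cancel_iff) auto
  ultimately have s: "1/6 \<le> l + ln (ln (real N))" using l by linarith
  have lnK: "0 \<le> ln K" using K by simp
  have "real n + 1 \<le> ln K + l + 2" using n K v ln2_ge_two_thirds by (simp add: l_def ln_mult)
  also have "\<dots> \<le> (2 * ln K + 5) * l"
    using mult_left_mono[OF l lnK] l lnK by (simp add: algebra_simps)
  finally have "(real n + 1)\<^sup>2 \<le> ((2 * ln K + 5) * l)\<^sup>2" by (intro power_mono) auto
  then have "1500000 * (K * real v) * (real n + 1)\<^sup>2 * ln N
      \<le> 1500000 * (K * real v) * ((2 * ln K + 5) * l)\<^sup>2 * ln N"
    using K lnN by (intro mult_right_mono mult_left_mono) auto
  also have "\<dots> = 9000000 * K * (2 * ln K + 5)\<^sup>2 * real v * ln N * l\<^sup>2 * (1/6)"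
    by (simp add: power_mult_distrib)
  also have "\<dots> \<le> 10^7 * K * (2 * ln K + 5)\<^sup>2 * real v * ln N * l\<^sup>2 * (l + ln (ln (real N)))"
    using K lnN s by (intro mult_mono) auto
  finally show ?thesis using m unfolding l_def by linarith
qed

section \<open>One-sided discretisation of sparse sums\<close>

text \<open>By homogeneity the sum may be normalised in L2. The frame inequality and Cauchy-Schwarz
  over \<open>v\<close> coefficients bound their l1-norm by \<open>sqrt (K * v)\<close>, which
  places the sum in \<open>B\<close> times the convex hull of the rotated dictionary and bounds it
  pointwise by \<open>2^n\<close>. So \<open>sampling_convex_hull\<close> applies.\<close>

lemma (in prob_space) sparse_sampling:
  fixes \<phi> :: "nat \<Rightarrow> 'a \<Rightarrow> complex"
  assumes K: "1 \<le> K" and N: "2 \<le> N" and v: "1 \<le> v" and m: "1 \<le> m"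
    and meas: "\<And>j. j \<in> {1..N} \<Longrightarrow> \<phi> j \<in> borel_measurable M"
    and bound: "\<And>j x. j \<in> {1..N} \<Longrightarrow> x \<in> space M \<Longrightarrow> cmod (\<phi> j x) \<le> 1"
    and frame: "\<And>a::nat \<Rightarrow> complex. (\<Sum>j=1..N. (cmod (a j))\<^sup>2)
          \<le> K * expectation (\<lambda>x. (cmod (\<Sum>j=1..N. a j * \<phi> j x))\<^sup>2)"
    and large: "10^7 * K * (2 * ln K + 5)\<^sup>2 * real v * ln (real N) * (ln (2 * real v))\<^sup>2
        * (ln (2 * real v) + ln (ln (real N))) \<le> real m"
  shows "\<exists>\<xi>::nat \<Rightarrow> 'a. (\<forall>\<nu>. \<xi> \<nu> \<in> space M) \<and>
     (\<forall>J a s. J \<subseteq> {1..N} \<longrightarrow> card J = v \<longrightarrow> (\<forall>\<nu><m. cmod (\<Sum>j\<in>J. a j * \<phi> j (\<xi> \<nu>)) \<le> s) \<longrightarrow>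
        expectation (\<lambda>x. (cmod (\<Sum>j\<in>J. a j * \<phi> j x))\<^sup>2) \<le> (4 * s)\<^sup>2)"
proof -
  define Q where "Q = K * real v"
  have Q: "1 \<le> Q" unfolding Q_def using K v by (simp add: mult_ge1_I)
  obtain n :: nat where n: "Q \<le> 4^n" "4^n \<le> 4 * Q" "real n \<le> ln Q + 1"
    using ex_power4_between[OF Q] by blast
  \<comment> \<open>The factor 2 pays for \<open>|Re z| + |Im z| <= 2 * cmod z\<close>, and together
    with \<open>4^n <= 4 * Q\<close> it gives \<open>2^n <= B\<close>.\<close>
  define B where "B = 2 * sqrt Q"
  have B0: "0 < B" using Q by (simp add: B_def)
  have four: "(2^n)\<^sup>2 = (4::real)^n" by (simp add: power2_eq_square flip: power_mult_distrib)
  have sqrt4: "sqrt (4^n) = 2^n" unfolding four[symmetric] by simp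
  have nB: "2^n \<le> B"
    using real_sqrt_le_mono[OF n(2)] by (simp add: B_def sqrt4 real_sqrt_mult)
  have Qn: "sqrt Q \<le> 2^n"
    using real_sqrt_le_mono[OF n(1)] by (simp add: sqrt4)
  define D where "D = {0..N} \<times> {..<4::nat}"
  have cD: "real (card D) = 4 * (real N + 1)" by (simp add: D_def)
  define \<psi> where "\<psi> d x = (if fst d = 0 then 0 else \<i> ^ snd d * \<phi> (fst d) x)" for d :: "nat \<times> nat" and x
  define k where "k i = nat \<lceil>81920 * Q * (real n + 1) / 4^i\<rceil>" for i :: nat
  have k0: "0 < 81920 * Q * (real n + 1) / 4^i" for i :: nat using Q by simp
  then have kpos: "0 < k i" for i unfolding k_def by simp
  have kge: "81920 * Q * (real n + 1) / 4^i \<le> real (k i)" for i unfolding k_def by linarith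
  have kle: "real (k i) \<le> 81920 * Q * (real n + 1) / 4^i + 1" for i
    using k0[of i] unfolding k_def by linarith
  have size: "1500000 * Q * (real n + 1)\<^sup>2 * ln N \<le> m"
    using level_count_bound[OF K v N _ large, of n] n(3) unfolding Q_def by simp
  have "\<exists>\<xi>::nat \<Rightarrow> 'a. (\<forall>\<nu>. \<xi> \<nu> \<in> space M) \<and>
     (\<forall>w g. (\<forall>d\<in>D. 0 \<le> w d) \<longrightarrow> (\<Sum>d\<in>D. w d) = 1 \<longrightarrow>
        (\<forall>x. g x = complex_of_real B * (\<Sum>d\<in>D. complex_of_real (w d) * \<psi> d x)) \<longrightarrow>
        (\<forall>x\<in>space M. cmod (g x) \<le> 2^n) \<longrightarrow> expectation (\<lambda>x. (cmod (g x))\<^sup>2) = 1 \<longrightarrow>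
        (\<exists>\<nu><m. 1/4 \<le> cmod (g (\<xi> \<nu>))))"
  proof (rule sampling_convex_hull)
    show "finite D" by (simp add: D_def)
    have "(0, 0) \<in> D" by (simp add: D_def)
    then show "D \<noteq> {}" by blast
    show "cmod (\<psi> d x) \<le> 1" if "d \<in> D" "x \<in> space M" for d x
      using that bound by (auto simp: D_def \<psi>_def norm_mult norm_power)
    show "\<psi> d \<in> borel_measurable M" if "d \<in> D" for d
      using that meas by (cases "fst d = 0") (auto simp: D_def \<psi>_def[abs_def])
    show "0 < m" using m by simp
    show "2^n \<le> B" by (rule nB)
    show "0 < k i" for i by (rule kpos)
    show "8 * exp (- (real (k i) * (2^i / (8 * B))\<^sup>2 / 64)) \<le> 3 / (32 * (real n + 1) * 4^i)"
      if "i \<le> n" for i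
      unfolding B_def by (rule maurey_tail_bound[OF Q that kge])
    show "real (k i) * ln (card D) + ln (real n + 1) < real m * (15 / (64 * (real n + 1) * 4^i))"
      if "i \<le> n" for i
      unfolding cD
    proof (rule sample_size_bound[OF Q N _ kle size])
      have "(4::real)^i \<le> 4^n" using that by simp
      then show "4^i \<le> 4 * Q" using n(2) by linarith
    qed
  qed
  then obtain \<xi> :: "nat \<Rightarrow> 'a" where \<xi>: "\<And>\<nu>. \<xi> \<nu> \<in> space M"
    and hit: "\<And>w g. (\<forall>d\<in>D. 0 \<le> w d) \<Longrightarrow> (\<Sum>d\<in>D. w d) = 1 \<Longrightarrow>
        (\<forall>x. g x = complex_of_real B * (\<Sum>d\<in>D. complex_of_real (w d) * \<psi> d x)) \<Longrightarrow>
        (\<forall>x\<in>space M. cmod (g x) \<le> 2^n) \<Longrightarrow> expectation (\<lambda>x. (cmod (g x))\<^sup>2) = 1 \<Longrightarrow>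
        (\<exists>\<nu><m. 1/4 \<le> cmod (g (\<xi> \<nu>)))"
    by blast
  have "expectation (\<lambda>x. (cmod (\<Sum>j\<in>J. a j * \<phi> j x))\<^sup>2) \<le> (4 * s)\<^sup>2"
    if J: "J \<subseteq> {1..N}" "card J = v" and s: "\<forall>\<nu><m. cmod (\<Sum>j\<in>J. a j * \<phi> j (\<xi> \<nu>)) \<le> s" for J a s
  proof -
    define G where "G x = (\<Sum>j\<in>J. a j * \<phi> j x)" for x
    define q where "q = sqrt (expectation (\<lambda>x. (cmod (G x))\<^sup>2))"
    have e0: "0 \<le> expectation (\<lambda>x. (cmod (G x))\<^sup>2)" by simp
    have q2: "q\<^sup>2 = expectation (\<lambda>x. (cmod (G x))\<^sup>2)" unfolding q_def using e0 by simp
    have "q \<le> 4 * s"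
    proof (cases "q = 0")
      case True
      \<comment> \<open>As \<open>m >= 1\<close> there is a sample point, and it forces
        \<open>s\<close> to be nonnegative.\<close>
      have "cmod (\<Sum>j\<in>J. a j * \<phi> j (\<xi> 0)) \<le> s" using s m by simp
      then have "0 \<le> s" using norm_ge_zero order_trans by blast
      then show ?thesis using True by simp
    next
      case False
      then have q: "0 < q" using e0 unfolding q_def by (simp add: less_le)
      define b where "b j = (if j \<in> J then a j / q else 0)" for j
      define g where "g x = G x / q" for x
      have gb: "(\<Sum>j=1..N. b j * \<phi> j x) = g x" for x
      proof -
        have "(\<Sum>j=1..N. b j * \<phi> j x) = (\<Sum>j\<in>J. b j * \<phi> j x)"
          using J by (intro sum.mono_neutral_right) (auto simp: b_def)
        then show ?thesis by (simp add: g_def G_def b_def sum_divide_distrib)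
      qed
      have g1: "expectation (\<lambda>x. (cmod (g x))\<^sup>2) = 1"
        using q by (simp add: g_def norm_divide power_divide q2[symmetric])
      have l2: "(\<Sum>j\<in>J. (cmod (b j))\<^sup>2) \<le> K"
      proof -
        have "(\<Sum>j\<in>J. (cmod (b j))\<^sup>2) \<le> (\<Sum>j=1..N. (cmod (b j))\<^sup>2)"
          using J by (intro sum_mono2) auto
        also have "\<dots> \<le> K" using frame[of b] unfolding gb g1 by simp
        finally show ?thesis .
      qed
      have "(\<Sum>j\<in>J. cmod (b j))\<^sup>2 \<le> (\<Sum>j\<in>J. (cmod (b j))\<^sup>2) * (\<Sum>j\<in>J. 1\<^sup>2)"
        using Cauchy_Schwarz_ineq_sum[of "\<lambda>j. cmod (b j)" "\<lambda>_. 1" J] by simp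
      also have "\<dots> \<le> Q" using l2 J by (simp add: Q_def mult_right_mono)
      finally have "(\<Sum>j\<in>J. cmod (b j)) \<le> sqrt Q" by (rule real_le_rsqrt)
      also have "(\<Sum>j\<in>J. cmod (b j)) = (\<Sum>j=1..N. cmod (b j))"
        using J by (intro sum.mono_neutral_left) (auto simp: b_def)
      finally have l1: "(\<Sum>j=1..N. cmod (b j)) \<le> sqrt Q" .
      have "(\<Sum>j=1..N. \<bar>Re (b j)\<bar> + \<bar>Im (b j)\<bar>) \<le> (\<Sum>j=1..N. 2 * cmod (b j))"
      proof (rule sum_mono)
        show "\<bar>Re (b j)\<bar> + \<bar>Im (b j)\<bar> \<le> 2 * cmod (b j)" for j
          using abs_Re_le_cmod[of "b j"] abs_Im_le_cmod[of "b j"] by linarith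
      qed
      also have "\<dots> \<le> B" using l1 by (simp add: B_def sum_distrib_left[symmetric])
      finally have "(\<Sum>j=1..N. \<bar>Re (b j)\<bar> + \<bar>Im (b j)\<bar>) \<le> B" .
      from four_phase_combination[OF B0 this, folded D_def]
      obtain w :: "nat \<times> nat \<Rightarrow> real" where w: "\<forall>d\<in>D. 0 \<le> w d" "(\<Sum>d\<in>D. w d) = 1"
        and wf: "\<forall>f. (\<Sum>j=1..N. b j * f j) = complex_of_real B *
          (\<Sum>d\<in>D. complex_of_real (w d) * (if fst d = 0 then 0 else \<i> ^ snd d * f (fst d)))"
        by (elim exE conjE) (rule that)
      have "\<exists>\<nu><m. 1/4 \<le> cmod (g (\<xi> \<nu>))"
      proof (rule hit[OF w])
        show "\<forall>x. g x = complex_of_real B * (\<Sum>d\<in>D. complex_of_real (w d) * \<psi> d x)"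
          using wf[rule_format, of "\<lambda>j. \<phi> j _"] unfolding gb \<psi>_def by (intro allI)
        show "\<forall>x\<in>space M. cmod (g x) \<le> 2^n"
        proof
          fix x assume x: "x \<in> space M"
          have "cmod (g x) \<le> (\<Sum>j=1..N. cmod (b j * \<phi> j x))"
            unfolding gb[symmetric] by (rule norm_sum)
          also have "\<dots> \<le> (\<Sum>j=1..N. cmod (b j))"
            using bound x by (intro sum_mono) (simp add: norm_mult mult_left_le)
          finally show "cmod (g x) \<le> 2^n" using l1 Qn by linarith
        qed
        show "expectation (\<lambda>x. (cmod (g x))\<^sup>2) = 1" by (rule g1)
      qed
      then obtain \<nu> where \<nu>: "\<nu> < m" "1/4 \<le> cmod (g (\<xi> \<nu>))" by blast
      have "cmod (g (\<xi> \<nu>)) = cmod (G (\<xi> \<nu>)) / q" using q by (simp add: g_def norm_divide)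
      moreover have "q * 1 \<le> q * (4 * cmod (g (\<xi> \<nu>)))"
        using \<nu>(2) q by (intro mult_left_mono) auto
      ultimately have "q \<le> 4 * cmod (G (\<xi> \<nu>))" using q by simp
      also have "\<dots> \<le> 4 * s" using s \<nu>(1) by (simp add: G_def)
      finally show ?thesis .
    qed
    moreover have "0 \<le> q" using e0 by (simp add: q_def)
    ultimately have "q\<^sup>2 \<le> (4 * s)\<^sup>2" by (intro power_mono)
    then show ?thesis unfolding q2 G_def .
  qed
  then show ?thesis using \<xi> by blast
qed

text \<open>With one dictionary element the logarithmic bound on \<open>m\<close> is void; a single maximum
  point of that element suffices.\<close>

lemma single_function_sampling:
  fixes \<phi> :: "'a::topological_space \<Rightarrow> complex"
  assumes "prob_space M" and "compact (space M)" "continuous_on (space M) \<phi>"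
  shows "\<exists>x0\<in>space M. \<forall>a s. cmod (a * \<phi> x0) \<le> s \<longrightarrow> (\<integral>x. (cmod (a * \<phi> x))\<^sup>2 \<partial>M) \<le> (4 * s)\<^sup>2"
proof -
  interpret prob_space M by fact
  have "continuous_on (space M) (\<lambda>x. cmod (\<phi> x))" using assms by (intro continuous_intros)
  from continuous_attains_sup[OF assms(2) not_empty this]
  obtain x0 where x0: "x0 \<in> space M" "\<And>y. y \<in> space M \<Longrightarrow> cmod (\<phi> y) \<le> cmod (\<phi> x0)" by blast
  have "expectation (\<lambda>x. (cmod (a * \<phi> x))\<^sup>2) \<le> (4 * s)\<^sup>2" if s: "cmod (a * \<phi> x0) \<le> s" for a s
  proof (cases "integrable M (\<lambda>x. (cmod (a * \<phi> x))\<^sup>2)")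
    case True
    have "0 \<le> s" using s norm_ge_zero order_trans by blast
    have "expectation (\<lambda>x. (cmod (a * \<phi> x))\<^sup>2) \<le> expectation (\<lambda>x. (4 * s)\<^sup>2)"
    proof (rule integral_mono[OF True])
      fix x assume x: "x \<in> space M"
      have "cmod (a * \<phi> x) \<le> cmod (a * \<phi> x0)"
        using x0(2)[OF x] by (simp add: norm_mult mult_left_mono)
      then have "cmod (a * \<phi> x) \<le> 4 * s" using s \<open>0 \<le> s\<close> by linarith
      then show "(cmod (a * \<phi> x))\<^sup>2 \<le> (4 * s)\<^sup>2" by (intro power_mono) auto
    qed simp
    then show ?thesis by (simp add: prob_space)
  \<comment> \<open>Otherwise the integral is 0 by convention and the bound is trivial.\<close>
  qed (simp add: not_integrable_integral_eq)
  then show ?thesis using x0(1) by blast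
qed

text \<open>The pointwise inequality \<open>y <= (b + y^2 / b) / 2\<close> replaces Cauchy-Schwarz;
  the same majorant also yields integrability of \<open>g\<close>.\<close>

lemma (in prob_space) norm_expectation_le_of_square:
  fixes g :: "'a \<Rightarrow> complex"
  assumes "g \<in> borel_measurable M" "integrable M (\<lambda>x. (cmod (g x))\<^sup>2)"
    and "expectation (\<lambda>x. (cmod (g x))\<^sup>2) \<le> b\<^sup>2" "0 < b"
  shows "cmod (expectation g) \<le> b"
proof -
  have amgm: "y \<le> (b + y\<^sup>2 / b) / 2" for y :: real
    using assms(4) sum_squares_bound[of b y] by (simp add: field_simps power2_eq_square)
  have int: "integrable M (\<lambda>x. (b + (cmod (g x))\<^sup>2 / b) / 2)" using assms(2) by simp
  have "cmod (expectation g) \<le> expectation (\<lambda>x. (b + (cmod (g x))\<^sup>2 / b) / 2)"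
  proof (rule order_trans[OF Bochner_Integration.integral_norm_bound])
    have "integrable M g"
      by (rule Bochner_Integration.integrable_bound[OF int assms(1)]) (use amgm assms(4) in auto)
    then show "expectation (\<lambda>x. cmod (g x)) \<le> expectation (\<lambda>x. (b + (cmod (g x))\<^sup>2 / b) / 2)"
      using int amgm by (intro integral_mono) auto
  qed
  also have "\<dots> = (b + expectation (\<lambda>x. (cmod (g x))\<^sup>2) / b) / 2"
    using assms(2) by (simp add: prob_space)
  also have "\<dots> \<le> b"
    using assms(3,4) by (simp add: field_simps power2_eq_square)
  finally show ?thesis .
qed

subsection \<open>Numerical integration\<close>

text \<open>Let \<open>f\<close> in the ball vanish at the points and let \<open>g\<close> be sparse
  with \<open>|f - g| <= b\<close>. Then \<open>|g| <= b\<close> at the points, so the L2-norm of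
  \<open>g\<close> is at most \<open>4 * b\<close>, and the integral of \<open>f\<close> is at most
  \<open>b + 4 * b\<close> in modulus. \<open>linear_rule_of_zero_data\<close> turns this into one
  rule for the whole ball.\<close>

lemma kappa_le_five_sigma:
  fixes \<Omega> :: "'x::topological_space set"
  assumes \<Omega>: "compact \<Omega>" and \<mu>: "prob_space \<mu>" "sets \<mu> = sets (restrict_space borel \<Omega>)"
    and v: "v \<le> N"
    and cont: "\<And>j. j \<in> {1..N} \<Longrightarrow> continuous_on \<Omega> (\<phi> j)"
    and bound: "\<And>j x. j \<in> {1..N} \<Longrightarrow> x \<in> \<Omega> \<Longrightarrow> cmod (\<phi> j x) \<le> 1"
    and V: "banach_subspace_C \<Omega> V nv"
    and \<xi>: "\<And>\<nu>. \<nu> < m \<Longrightarrow> \<xi> \<nu> \<in> \<Omega>"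
    and sampling: "\<And>J a s. J \<subseteq> {1..N} \<Longrightarrow> card J = v \<Longrightarrow>
        (\<forall>\<nu><m. cmod (\<Sum>j\<in>J. a j * \<phi> j (\<xi> \<nu>)) \<le> s) \<Longrightarrow>
        (\<integral>x. (cmod (\<Sum>j\<in>J. a j * \<phi> j x))\<^sup>2 \<partial>\<mu>) \<le> (4 * s)\<^sup>2"
  shows "kappa m \<mu> \<Omega> {f \<in> V. nv f \<le> 1} \<le> 5 * sigma_inf v N \<phi> \<Omega> {f \<in> V. nv f \<le> 1}"
proof -
  interpret prob_space \<mu> by fact
  let ?W = "{f \<in> V. nv f \<le> 1}"
  have sp: "space \<mu> = \<Omega>" using sets_eq_imp_space_eq[OF \<mu>(2)] by (simp add: space_restrict_space)
  have meas: "f \<in> borel_measurable \<mu>" if "continuous_on \<Omega> f" for f :: "'x \<Rightarrow> complex"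
    using borel_measurable_continuous_on_restrict[OF that] measurable_cong_sets[OF \<mu>(2) refl] by auto
  have bdd: "\<exists>b. \<forall>x\<in>\<Omega>. cmod (f x) \<le> b" if "continuous_on \<Omega> f" for f :: "'x \<Rightarrow> complex"
    using compact_imp_bounded[OF compact_continuous_image[OF that \<Omega>]] unfolding bounded_iff by auto
  have int: "integrable \<mu> f" if c: "continuous_on \<Omega> f" for f :: "'x \<Rightarrow> complex"
  proof -
    obtain b where "\<forall>x\<in>\<Omega>. cmod (f x) \<le> b" using bdd[OF c] by blast
    then show ?thesis using meas[OF c] sp by (intro integrable_const_bound[where B=b]) auto
  qed
  have int2: "integrable \<mu> (\<lambda>x. (cmod (f x))\<^sup>2)" if c: "continuous_on \<Omega> f" for f :: "'x \<Rightarrow> complex"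
  proof -
    obtain b where b: "\<forall>x\<in>\<Omega>. cmod (f x) \<le> b" using bdd[OF c] by blast
    then have "AE x in \<mu>. norm ((cmod (f x))\<^sup>2) \<le> b\<^sup>2"
      using sp by (intro AE_I2) (auto intro!: power_mono)
    moreover have "(\<lambda>x. (cmod (f x))\<^sup>2) \<in> borel_measurable \<mu>" using meas[OF c] by measurable
    ultimately show ?thesis by (rule integrable_const_bound)
  qed
  note V' = V[unfolded banach_subspace_C_def]
  have Vc: "continuous_on \<Omega> f" if "f \<in> V" for f using V' that by blast
  have V0: "(\<lambda>x. 0) \<in> V" using V' by blast
  have Vadd: "(\<lambda>x. f x + g x) \<in> V" "nv (\<lambda>x. f x + g x) \<le> nv f + nv g" if "f \<in> V" "g \<in> V" for f g
    using V' that by blast+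
  have Vsc: "(\<lambda>x. c * f x) \<in> V" "nv (\<lambda>x. c * f x) = cmod c * nv f" if "f \<in> V" for c f
    using V' that by blast+
  have nv0: "0 \<le> nv f" "nv f = 0 \<longleftrightarrow> f = (\<lambda>x. 0)" if "f \<in> V" for f using V' that by blast+
  define \<sigma> where "\<sigma> = sigma_inf v N \<phi> \<Omega> ?W"
  \<comment> \<open>The zero function lies in the ball and \<open>\<Omega>\<close> is nonempty, so
    the supremum is not negative; apart from the trivial infinite case it is then a real
    number.\<close>
  have "0 \<le> \<sigma>"
  proof -
    obtain x0 where x0: "x0 \<in> \<Omega>" using not_empty sp by blast
    have "(\<lambda>x. 0) \<in> ?W" using V0 nv0[OF V0] by simp
    moreover have "(0::ereal) \<le> (INF g \<in> sparse_span v N \<phi>. SUP x \<in> \<Omega>. ereal (cmod (0 - g x)))"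
      by (intro INF_greatest SUP_upper2[OF x0]) simp
    ultimately show ?thesis
      unfolding \<sigma>_def sigma_inf_def by (intro SUP_upper2) auto
  qed
  show ?thesis
  proof (cases "\<sigma> = \<infinity>")
    case True
    then show ?thesis by (simp add: \<sigma>_def)
  next
    case False
    then obtain r where r: "\<sigma> = ereal r" "0 \<le> r" using \<open>0 \<le> \<sigma>\<close> by (cases \<sigma>) auto
    have ball: "cmod (expectation f) \<le> 5 * r"
      if f: "f \<in> V" "nv f \<le> 1" "\<forall>\<nu><m. f (\<xi> \<nu>) = 0" for f
    proof (rule field_le_epsilon)
      fix e :: real assume "0 < e"
      \<comment> \<open>The infimum over sparse sums need not be attained; the slack is chosen so
        that \<open>5 * b = 5 * r + e\<close>, and it makes \<open>b\<close> positive even if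
        \<open>r = 0\<close>.\<close>
      define b where "b = r + e / 5"
      have b: "0 < b" using r \<open>0 < e\<close> by (simp add: b_def)
      have "(INF g \<in> sparse_span v N \<phi>. SUP x \<in> \<Omega>. ereal (cmod (f x - g x))) \<le> \<sigma>"
        unfolding \<sigma>_def sigma_inf_def using f by (intro SUP_upper) auto
      also have "\<sigma> < ereal b" using r \<open>0 < e\<close> by (simp add: b_def)
      finally obtain g where g: "g \<in> sparse_span v N \<phi>" "(SUP x \<in> \<Omega>. ereal (cmod (f x - g x))) < ereal b"
        unfolding INF_less_iff by blast
      have fg: "cmod (f x - g x) \<le> b" if "x \<in> \<Omega>" for x
      proof -
        have "ereal (cmod (f x - g x)) \<le> (SUP x \<in> \<Omega>. ereal (cmod (f x - g x)))"
          using that by (rule SUP_upper)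
        also note g(2)
        finally show ?thesis by simp
      qed
      obtain J a where J: "J \<subseteq> {1..N}" "card J = v" "g = (\<lambda>x. \<Sum>j\<in>J. a j * \<phi> j x)"
        using g(1) unfolding sparse_span_def by blast
      have gc: "continuous_on \<Omega> g"
        unfolding J(3) using J(1) cont by (intro continuous_intros) auto
      have "cmod (g (\<xi> \<nu>)) \<le> b" if "\<nu> < m" for \<nu>
        using fg[OF \<xi>[OF that]] f(3) that by simp
      then have "expectation (\<lambda>x. (cmod (g x))\<^sup>2) \<le> (4 * b)\<^sup>2"
        using sampling[OF J(1,2), of a b] unfolding J(3) by blast
      then have Ig: "cmod (expectation g) \<le> 4 * b"
        using b by (intro norm_expectation_le_of_square meas[OF gc] int2[OF gc]) auto
      have fgi: "integrable \<mu> (\<lambda>x. f x - g x)"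
        by (rule Bochner_Integration.integrable_diff[OF int[OF Vc[OF f(1)]] int[OF gc]])
      have "cmod (expectation (\<lambda>x. f x - g x)) \<le> expectation (\<lambda>x. cmod (f x - g x))"
        by (rule Bochner_Integration.integral_norm_bound)
      also have "\<dots> \<le> expectation (\<lambda>x. b)"
        using fgi fg sp by (intro integral_mono) auto
      finally have "cmod (expectation (\<lambda>x. f x - g x)) \<le> b" by (simp add: prob_space)
      moreover have "expectation (\<lambda>x. f x - g x) = expectation f - expectation g"
        by (rule Bochner_Integration.integral_diff[OF int[OF Vc[OF f(1)]] int[OF gc]])
      ultimately have "cmod (expectation f) \<le> b + 4 * b"
        using Ig norm_triangle_sub[of "expectation f" "expectation g"] by simp
      then show "cmod (expectation f) \<le> 5 * r + e" by (simp add: b_def)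
    qed
    have zero: "cmod (expectation f) \<le> 5 * r * nv f" if f: "f \<in> V" "\<forall>\<nu><m. f (\<xi> \<nu>) = 0" for f
    proof (cases "nv f = 0")
      case True
      then show ?thesis using nv0(2)[OF f(1)] by simp
    next
      case False
      then have p: "0 < nv f" using nv0(1)[OF f(1)] by simp
      define c where "c = complex_of_real (1 / nv f)"
      have "cmod (expectation (\<lambda>x. c * f x)) \<le> 5 * r"
      proof (rule ball)
        have "cmod c = 1 / nv f" using p unfolding c_def norm_of_real by simp
        then show "nv (\<lambda>x. c * f x) \<le> 1" using Vsc(2)[OF f(1), of c] p by simp
      qed (use Vsc(1) f in auto)
      then show ?thesis using p by (simp add: c_def norm_divide field_simps)
    qed
    have "\<exists>w. \<forall>f\<in>V. cmod (expectation f - (\<Sum>\<nu><m. w \<nu> * f (\<xi> \<nu>))) \<le> 5 * r * nv f"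
      by (rule linear_rule_of_zero_data[OF _ _ _ zero])
         (use Vadd Vsc int Vc r in auto)
    then obtain w where w: "\<And>f. f \<in> V \<Longrightarrow> cmod (expectation f - (\<Sum>\<nu><m. w \<nu> * f (\<xi> \<nu>))) \<le> 5 * r * nv f"
      by blast
    have "kappa m \<mu> \<Omega> ?W \<le> (SUP f \<in> ?W. ereal (cmod (expectation f - (\<Sum>\<nu><m. w \<nu> * f (\<xi> \<nu>)))))"
      unfolding kappa_def using \<xi> by (intro INF_lower2[of "(\<xi>, w)"]) auto
    also have "\<dots> \<le> ereal (5 * r)"
    proof (rule SUP_least)
      fix f assume f: "f \<in> ?W"
      then have "5 * r * nv f \<le> 5 * r" using r by (simp add: mult_left_le)
      then show "ereal (cmod (expectation f - (\<Sum>\<nu><m. w \<nu> * f (\<xi> \<nu>)))) \<le> ereal (5 * r)"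
        using w[of f] f by simp
    qed
    also have "ereal (5 * r) = 5 * \<sigma>" using r by simp
    finally show ?thesis by (simp add: \<sigma>_def)
  qed
qed

section \<open>Choice of the constant and the two cases for the dictionary size\<close>

theorem theorem4p5:
  fixes K :: real
  assumes "K > 0"
  shows "\<exists>C>0. \<forall>(d::nat) (\<Omega>::(nat \<Rightarrow> real) set) (\<mu>::(nat \<Rightarrow> real) measure) (v::nat) (N::nat)
            (\<phi>::nat \<Rightarrow> (nat \<Rightarrow> real) \<Rightarrow> complex) (V::((nat \<Rightarrow> real) \<Rightarrow> complex) set)
            (nv::((nat \<Rightarrow> real) \<Rightarrow> complex) \<Rightarrow> real) (m::nat).
      compact \<Omega> \<and> \<Omega> \<subseteq> {x. \<forall>i\<ge>d. x i = 0} \<and>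
      prob_space \<mu> \<and> sets \<mu> = sets (restrict_space borel \<Omega>) \<and>
      1 \<le> v \<and> v \<le> N \<and>
      (\<forall>j\<in>{1..N}. continuous_on \<Omega> (\<phi> j) \<and> (\<forall>x\<in>\<Omega>. cmod (\<phi> j x) \<le> 1)) \<and>
      (\<forall>a::nat \<Rightarrow> complex. (\<Sum>j=1..N. (cmod (a j))^2)
          \<le> K * integral\<^sup>L \<mu> (\<lambda>x. (cmod (\<Sum>j=1..N. a j * \<phi> j x))^2)) \<and>
      banach_subspace_C \<Omega> V nv \<and>
      1 \<le> m \<and>
      real m \<ge> C * real v * ln (real N) * (ln (2 * real v))^2 * (ln (2 * real v) + ln (ln (real N)))
      \<longrightarrow> kappa m \<mu> \<Omega> {f \<in> V. nv f \<le> 1} \<le> 5 * sigma_inf v N \<phi> \<Omega> {f \<in> V. nv f \<le> 1}"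
proof -
  \<comment> \<open>Enlarging \<open>K\<close> preserves the frame inequality and makes
    \<open>ln K'\<close> nonnegative.\<close>
  define K' where "K' = max K 1"
  have K': "1 \<le> K'" "K \<le> K'" by (auto simp: K'_def)
  \<comment> \<open>The factor demanded by \<open>sparse_sampling\<close>; it depends on
    \<open>K\<close> alone.\<close>
  define C where "C = 10^7 * K' * (2 * ln K' + 5)\<^sup>2"
  have "0 \<le> ln K'" using K' by simp
  then have "0 < (2 * ln K' + 5)\<^sup>2" by (intro zero_less_power) simp
  then have C: "0 < C" using K' by (simp add: C_def)
  show ?thesis
  proof (intro exI[of _ C] conjI C allI impI, elim conjE)
    fix d :: nat and \<Omega> :: "(nat \<Rightarrow> real) set" and \<mu> :: "(nat \<Rightarrow> real) measure" and v N :: nat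
      and \<phi> :: "nat \<Rightarrow> (nat \<Rightarrow> real) \<Rightarrow> complex" and V nv and m :: nat
    assume \<Omega>: "compact \<Omega>" and \<mu>: "prob_space \<mu>" "sets \<mu> = sets (restrict_space borel \<Omega>)"
      and v: "1 \<le> v" "v \<le> N"
      and \<phi>: "\<forall>j\<in>{1..N}. continuous_on \<Omega> (\<phi> j) \<and> (\<forall>x\<in>\<Omega>. cmod (\<phi> j x) \<le> 1)"
      and frame: "\<forall>a::nat \<Rightarrow> complex. (\<Sum>j=1..N. (cmod (a j))^2)
          \<le> K * integral\<^sup>L \<mu> (\<lambda>x. (cmod (\<Sum>j=1..N. a j * \<phi> j x))^2)"
      and V: "banach_subspace_C \<Omega> V nv" and m: "1 \<le> m"
      and large: "real m \<ge> C * real v * ln (real N) * (ln (2 * real v))^2 * (ln (2 * real v) + ln (ln (real N)))"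
    interpret prob_space \<mu> by fact
    have sp: "space \<mu> = \<Omega>" using sets_eq_imp_space_eq[OF \<mu>(2)] by (simp add: space_restrict_space)
    have "\<exists>\<xi>::nat \<Rightarrow> nat \<Rightarrow> real. (\<forall>\<nu>. \<xi> \<nu> \<in> \<Omega>) \<and>
      (\<forall>J a s. J \<subseteq> {1..N} \<longrightarrow> card J = v \<longrightarrow> (\<forall>\<nu><m. cmod (\<Sum>j\<in>J. a j * \<phi> j (\<xi> \<nu>)) \<le> s) \<longrightarrow>
        expectation (\<lambda>x. (cmod (\<Sum>j\<in>J. a j * \<phi> j x))\<^sup>2) \<le> (4 * s)\<^sup>2)"
    proof (cases "N = 1")
      case True
      then have "continuous_on (space \<mu>) (\<phi> 1)" using \<phi> sp by simp
      then obtain x0 where x0: "x0 \<in> \<Omega>" "\<And>a s. cmod (a * \<phi> 1 x0) \<le> s \<Longrightarrow>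
          expectation (\<lambda>x. (cmod (a * \<phi> 1 x))\<^sup>2) \<le> (4 * s)\<^sup>2"
        using single_function_sampling[of \<mu> "\<phi> 1"] \<mu>(1) \<Omega> sp by auto
      \<comment> \<open>Here \<open>v = 1\<close>, so only one index set occurs. Repeating the
        maximum point \<open>x0\<close> at every index suffices, and \<open>m >= 1\<close> ensures
        that it is sampled.\<close>
      have "J = {1}" if "J \<subseteq> {1..N}" "card J = v" for J
        using that True v by (metis atLeastAtMost_singleton card.empty le_zero_eq not_one_le_zero subset_singletonD)
      then have "expectation (\<lambda>x. (cmod (\<Sum>j\<in>J. a j * \<phi> j x))\<^sup>2) \<le> (4 * s)\<^sup>2"
        if "J \<subseteq> {1..N}" "card J = v" "\<forall>\<nu><m. cmod (\<Sum>j\<in>J. a j * \<phi> j x0) \<le> s" for J a s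
      proof -
        have J: "J = {1}" using \<open>\<And>J. J \<subseteq> {1..N} \<Longrightarrow> card J = v \<Longrightarrow> J = {1}\<close> that(1,2) .
        have "cmod (\<Sum>j\<in>J. a j * \<phi> j x0) \<le> s" using that(3)[rule_format, of 0] m by simp
        then show ?thesis using x0(2)[of "a 1" s] unfolding J by simp
      qed
      then show ?thesis using x0(1) by (intro exI[of _ "\<lambda>_. x0"]) blast
    next
      case False
      then have N: "2 \<le> N" using v by simp
      show ?thesis
        unfolding sp[symmetric]
      proof (rule sparse_sampling[OF K'(1) N v(1) m])
        show "\<phi> j \<in> borel_measurable \<mu>" if "j \<in> {1..N}" for j
          using borel_measurable_continuous_on_restrict[of \<Omega> "\<phi> j"] \<phi> that
            measurable_cong_sets[OF \<mu>(2) refl] by auto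
        show "cmod (\<phi> j x) \<le> 1" if "j \<in> {1..N}" "x \<in> space \<mu>" for j x
          using \<phi> that sp by auto
        show "(\<Sum>j=1..N. (cmod (a j))\<^sup>2) \<le> K' * expectation (\<lambda>x. (cmod (\<Sum>j=1..N. a j * \<phi> j x))\<^sup>2)"
          for a :: "nat \<Rightarrow> complex"
          using frame[rule_format, of a] K'(2)
          by (rule order_trans[OF _ mult_right_mono]) simp
        show "10^7 * K' * (2 * ln K' + 5)\<^sup>2 * real v * ln (real N) * (ln (2 * real v))\<^sup>2
            * (ln (2 * real v) + ln (ln (real N))) \<le> real m"
          using large unfolding C_def .
      qed
    qed
    then obtain \<xi> where \<xi>: "\<And>\<nu>. \<xi> \<nu> \<in> \<Omega>" and
      sampling: "\<And>J a s. J \<subseteq> {1..N} \<Longrightarrow> card J = v \<Longrightarrow>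
        (\<forall>\<nu><m. cmod (\<Sum>j\<in>J. a j * \<phi> j (\<xi> \<nu>)) \<le> s) \<Longrightarrow>
        expectation (\<lambda>x. (cmod (\<Sum>j\<in>J. a j * \<phi> j x))\<^sup>2) \<le> (4 * s)\<^sup>2"
      by blast
    show "kappa m \<mu> \<Omega> {f \<in> V. nv f \<le> 1} \<le> 5 * sigma_inf v N \<phi> \<Omega> {f \<in> V. nv f \<le> 1}"
      by (rule kappa_le_five_sigma[OF \<Omega> \<mu> v(2) _ _ V \<xi> sampling]) (use \<phi> in auto)
  qed
qed

end
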